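(* Let $K_1\subset\mathbb{R}^k$ and $K_2,K_3\subset\mathbb{R}^d$ be compact. Let $\nu$ be a Borel probability measure on $K_1\times K_2$ whose first marginal $m$ is centered, $\int_{K_1}\tilde x\,m(d\tilde x)=0$, and let $\mu$ be a Borel probability measure on $K_3$. Let $I(\mu,\nu)$ be the set of Borel probability measures $\theta$ on $K_1\times K_2\times K_3$ whose marginal on the $(\tilde x,y)$-coordinates is $\nu$ and whose marginal on the $(\tilde x,u)$-coordinates is $m\otimes\mu$. Then $$\max_{\theta\in I(\mu,\nu)}\int u^\top y\,\theta(d\tilde x,dy,du)=\inf\Big\{\int_{K_1\times K_2}\psi\,d\nu+\int_{K_1\times K_3}\varphi\,d(m\otimes\mu)\Big\},$$ where the infimum is over $(\psi,\varphi)\in C(K_1\times K_2)\times C(K_1\times K_3)$ satisfying $\psi(\tilde x,y)+\varphi(\tilde x,u)\ge u^\top y$ for all $(\tilde x,y,u)\in K_1\times K_2\times K_3$ (and the maximum is attained). This common value also equals the infimum of the same objective taken over $(\psi,\varphi)\in L^1(\nu)\times L^1(m\otimes\mu)$ satisfying the same constraint. *)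

theory Defs
  imports "HOL-Probability.Probability"
begin

text \<open>Borel probability measures on a compact set K are modelled as probability
measures on the Borel sigma-algebra of the ambient Euclidean space that give
full mass to K.\<close>

definition borel_prob_on :: "'a::euclidean_space set \<Rightarrow> 'a measure \<Rightarrow> bool" where
  "borel_prob_on K M \<longleftrightarrow> prob_space M \<and> sets M = sets borel \<and> emeasure M K = 1"

definition marg1 :: "('a::euclidean_space \<times> 'b::euclidean_space) measure \<Rightarrow> 'a measure" where
  "marg1 \<nu> = distr \<nu> borel fst"

definition I_set ::
  "'a::euclidean_space set \<Rightarrow> 'b::euclidean_space set \<Rightarrow> 'b set \<Rightarrow> 'b measure
   \<Rightarrow> ('a \<times> 'b) measure \<Rightarrow> ('a \<times> 'b \<times> 'b) measure set" where
  "I_set K1 K2 K3 \<mu> \<nu> =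
     {\<theta>. borel_prob_on (K1 \<times> K2 \<times> K3) \<theta> \<and>
          distr \<theta> borel (\<lambda>(x, y, u). (x, y)) = \<nu> \<and>
          distr \<theta> borel (\<lambda>(x, y, u). (x, u)) = (marg1 \<nu> \<Otimes>\<^sub>M \<mu>)}"

definition primal_obj :: "('a::euclidean_space \<times> 'b::euclidean_space \<times> 'b) measure \<Rightarrow> real" where
  "primal_obj \<theta> = (\<integral>(x, y, u). inner u y \<partial>\<theta>)"

definition dual_obj ::
  "'a::euclidean_space set \<Rightarrow> 'b::euclidean_space set \<Rightarrow> 'b set \<Rightarrow> 'b measure
   \<Rightarrow> ('a \<times> 'b) measure \<Rightarrow> ('a \<times> 'b \<Rightarrow> real) \<Rightarrow> ('a \<times> 'b \<Rightarrow> real) \<Rightarrow> real" where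
  "dual_obj K1 K2 K3 \<mu> \<nu> \<psi> \<phi> =
     (LINT z:K1 \<times> K2|\<nu>. \<psi> z) + (LINT z:K1 \<times> K3|(marg1 \<nu> \<Otimes>\<^sub>M \<mu>). \<phi> z)"

definition dual_feasible ::
  "'a::euclidean_space set \<Rightarrow> 'b::euclidean_space set \<Rightarrow> 'b set
   \<Rightarrow> ('a \<times> 'b \<Rightarrow> real) \<Rightarrow> ('a \<times> 'b \<Rightarrow> real) \<Rightarrow> bool" where
  "dual_feasible K1 K2 K3 \<psi> \<phi> \<longleftrightarrow>
     (\<forall>x\<in>K1. \<forall>y\<in>K2. \<forall>u\<in>K3. \<psi> (x, y) + \<phi> (x, u) \<ge> inner u y)"

definition dual_values_C ::
  "'a::euclidean_space set \<Rightarrow> 'b::euclidean_space set \<Rightarrow> 'b set \<Rightarrow> 'b measure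
   \<Rightarrow> ('a \<times> 'b) measure \<Rightarrow> real set" where
  "dual_values_C K1 K2 K3 \<mu> \<nu> =
     {dual_obj K1 K2 K3 \<mu> \<nu> \<psi> \<phi> | \<psi> \<phi>.
        continuous_on (K1 \<times> K2) \<psi> \<and> continuous_on (K1 \<times> K3) \<phi> \<and>
        dual_feasible K1 K2 K3 \<psi> \<phi>}"

definition dual_values_L1 ::
  "'a::euclidean_space set \<Rightarrow> 'b::euclidean_space set \<Rightarrow> 'b set \<Rightarrow> 'b measure
   \<Rightarrow> ('a \<times> 'b) measure \<Rightarrow> real set" where
  "dual_values_L1 K1 K2 K3 \<mu> \<nu> =
     {dual_obj K1 K2 K3 \<mu> \<nu> \<psi> \<phi> | \<psi> \<phi>.
        set_integrable \<nu> (K1 \<times> K2) \<psi> \<and>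
        set_integrable (marg1 \<nu> \<Otimes>\<^sub>M \<mu>) (K1 \<times> K3) \<phi> \<and>
        dual_feasible K1 K2 K3 \<psi> \<phi>}"

end

theory Submission
  imports Defs
begin

text \<open>Integrating the constraint gives \<open>primal \<le> dual\<close> for every admissible pair, so it suffices to
  find a coupling whose value is at least the infimum \<open>V\<close> of the continuous dual problem. Membership
  in the coupling set amounts to countably many moment equations with continuous test functions.
  Minimise the sum of the squared defects in these equations and in \<open>\<integral>u \<bullet> y \<ge> V\<close> over the weakly compact
  set of all probability measures on \<open>K1 \<times> K2 \<times> K3\<close>. If the minimum is positive, its first-order
  optimality condition is a continuous dual pair with value below \<open>V\<close>, which is absurd; the product
  coupling \<open>\<nu> \<otimes> \<mu>\<close> excludes the degenerate case in which the cost has multiplier zero. Weak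
  compactness follows from Helly's theorem on the real line, by lifting measures along a
  space-filling curve.\<close>

section \<open>A countable measure-determining family\<close>

text \<open>The truncated multiples of the distance to the complement increase pointwise to the
  indicator of \<open>U\<close> and are bounded by 1, so dominated convergence applies. The case
  \<open>U = UNIV\<close> is excluded because \<open>infdist\<close> to the empty set is 0 by
  convention.\<close>

lemma integral_infdist_tendsto_measure:
  fixes M :: "'a::metric_space measure"
  assumes "prob_space M" and sets: "sets M = sets borel" and U: "open U" "U \<noteq> UNIV"
  shows "(\<lambda>n. \<integral>z. min 1 (real n * infdist z (- U)) \<partial>M) \<longlonglongrightarrow> measure M U"
proof -
  interpret prob_space M by fact
  have [measurable]: "(\<lambda>z. min 1 (real n * infdist z (- U))) \<in> borel_measurable M" for n
    unfolding measurable_cong_sets[OF sets refl]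
    by (intro borel_measurable_continuous_onI continuous_intros)
  have [measurable]: "U \<in> sets M" using U by (simp add: sets)
  have lim: "(\<lambda>n. min 1 (real n * infdist z (- U))) \<longlonglongrightarrow> indicator U z" for z
  proof (cases "z \<in> U")
    case True
    have "infdist z (- U) > 0"
      using U True by (intro infdist_pos_not_in_closed) auto
    then obtain n0 where "real n0 * infdist z (- U) > 1"
      using reals_Archimedean3 by blast
    then have "min 1 (real n * infdist z (- U)) = 1" if "n \<ge> n0" for n
      using that \<open>infdist z (- U) > 0\<close>
      by (smt (verit) mult_right_mono of_nat_mono)
    then have "eventually (\<lambda>n. min 1 (real n * infdist z (- U)) = 1) sequentially"
      unfolding eventually_sequentially by blast
    then show ?thesis
      using True by (simp add: tendsto_eventually)
  next
    case False
    then show ?thesis by simp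
  qed
  have "(\<lambda>n. \<integral>z. min 1 (real n * infdist z (- U)) \<partial>M) \<longlonglongrightarrow> (\<integral>z. indicator U z \<partial>M)"
    by (rule integral_dominated_convergence[where w="\<lambda>_. 1"])
       (auto simp: lim infdist_nonneg)
  then show ?thesis by simp
qed

definition measure_determining :: "('i \<Rightarrow> 'a::topological_space \<Rightarrow> real) \<Rightarrow> bool" where
  "measure_determining p \<longleftrightarrow> (\<forall>M N. prob_space M \<longrightarrow> prob_space N \<longrightarrow> sets M = sets borel \<longrightarrow>
     sets N = sets borel \<longrightarrow> (\<forall>i. integral\<^sup>L M (p i) = integral\<^sup>L N (p i)) \<longrightarrow> M = N)"

lemma measure_determiningD:
  assumes "measure_determining p" "prob_space M" "prob_space N"
    "sets M = sets borel" "sets N = sets borel" "\<And>i. integral\<^sup>L M (p i) = integral\<^sup>L N (p i)"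
  shows "M = N"
  using assms unfolding measure_determining_def by blast

text \<open>Finite intersections of a countable base form a countable intersection-stable generator
  of the Borel sets. The cut-off distance functions of its members recover their measures as limits,
  so countably many continuous integrals determine a probability measure.\<close>

lemma countable_measure_determining_family:
  obtains p :: "nat \<Rightarrow> 'a::{metric_space, second_countable_topology} \<Rightarrow> real"
  where "\<And>i. continuous_on UNIV (p i)" and "\<And>i z. 0 \<le> p i z" and "\<And>i z. p i z \<le> 1"
    and "measure_determining p"
proof -
  obtain B :: "'a set set" where B: "countable B" "topological_basis B"
    using ex_countable_basis by blast
  define D where "D = (\<lambda>F. \<Inter>F) ` {F. finite F \<and> F \<subseteq> B}"
  have "countable D"
    unfolding D_def using B by (intro countable_image countable_Collect_finite_subset)
  \<comment> \<open>The whole space is the empty intersection; it serves as the exhausting sequence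
    in the generator argument below.\<close>
  have "UNIV \<in> D" unfolding D_def by (rule image_eqI[of _ _ "{}"]) auto
  have "B \<subseteq> D"
  proof
    fix b assume "b \<in> B" then show "b \<in> D"
      unfolding D_def by (intro image_eqI[of _ _ "{b}"]) auto
  qed
  have D_open: "open U" if "U \<in> D" for U
    using that topological_basis_open[OF B(2)] unfolding D_def by (auto intro!: open_Inter)
  have "Int_stable D"
  proof (rule Int_stableI)
    fix a b assume "a \<in> D" "b \<in> D"
    then obtain F G where "finite F" "F \<subseteq> B" "a = \<Inter>F" "finite G" "G \<subseteq> B" "b = \<Inter>G"
      unfolding D_def by auto
    then show "a \<inter> b \<in> D"
      unfolding D_def by (intro image_eqI[of _ _ "F \<union> G"]) auto
  qed
  have borel_D: "sets borel = sigma_sets UNIV D"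
  proof
    show "sets borel \<subseteq> sigma_sets UNIV D"
      unfolding borel_eq_countable_basis[OF B] using \<open>B \<subseteq> D\<close>
      by (auto intro: sigma_sets_mono'[THEN subsetD])
    show "sigma_sets UNIV D \<subseteq> sets borel"
      using sets.sigma_sets_subset[of D borel] D_open by (simp add: subset_iff)
  qed
  \<comment> \<open>An index is a generator set together with the steepness of its cut-off;
    \<open>from_nat_into\<close> enumerates these pairs.\<close>
  define I where "I = D \<times> (UNIV :: nat set)"
  have I: "countable I" "I \<noteq> {}"
    using \<open>countable D\<close> \<open>UNIV \<in> D\<close> by (auto simp: I_def)
  define p where "p i = (\<lambda>z. min 1 (real (snd (from_nat_into I i)) * infdist z (- fst (from_nat_into I i))))" for i
  show thesis
  proof (rule that[of p])
    show "continuous_on UNIV (p i)" for i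
      unfolding p_def by (intro continuous_intros)
    show "0 \<le> p i z" "p i z \<le> 1" for i z
      by (auto simp: p_def infdist_nonneg)
    show "measure_determining p"
      unfolding measure_determining_def
    proof (intro allI impI)
      fix M N :: "'a measure"
      assume M: "prob_space M" and N: "prob_space N"
        and sets: "sets M = sets borel" "sets N = sets borel"
        and eq: "\<forall>i. integral\<^sup>L M (p i) = integral\<^sup>L N (p i)"
      interpret M: prob_space M by fact
      interpret N: prob_space N by fact
      have sp: "space M = UNIV" "space N = UNIV"
        using sets_eq_imp_space_eq[OF sets(1)] sets_eq_imp_space_eq[OF sets(2)] by auto
      have emeas: "emeasure M U = emeasure N U" if "U \<in> D" for U
      proof (cases "U = UNIV")
        case True
        then show ?thesis using M.emeasure_space_1 N.emeasure_space_1 sp by simp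
      next
        case False
        have "(\<integral>z. min 1 (real n * infdist z (- U)) \<partial>M) = (\<integral>z. min 1 (real n * infdist z (- U)) \<partial>N)" for n
        proof -
          have "(U, n) \<in> I" using that by (simp add: I_def)
          then obtain i where "from_nat_into I i = (U, n)"
            using from_nat_into_surj[OF I(1)] by blast
          then show ?thesis using eq[rule_format, of i] by (simp add: p_def)
        qed
        then have "measure M U = measure N U"
          using integral_infdist_tendsto_measure[OF M sets(1) D_open[OF that] False]
            integral_infdist_tendsto_measure[OF N sets(2) D_open[OF that] False]
          by (auto intro: LIMSEQ_unique)
        then show ?thesis
          by (simp add: M.emeasure_eq_measure N.emeasure_eq_measure)
      qed
      show "M = N"
        by (rule measure_eqI_generator_eq[OF \<open>Int_stable D\<close> _ emeas, where \<Omega>=UNIV and A="\<lambda>_. UNIV"])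
           (use \<open>UNIV \<in> D\<close> in \<open>auto simp: sets borel_D\<close>)
    qed
  qed
qed

section \<open>A space-filling curve\<close>

text \<open>An even continuous function of period 2 with plateau 0 around the even integers and
  plateau 1 around the odd ones. It plays the role of the piecewise linear function in Schoenberg's
  curve.\<close>

definition clamped_wave :: "real \<Rightarrow> real" where
  "clamped_wave t = max 0 (min 1 (1 / 2 - cos (pi * t)))"

lemma continuous_clamped_wave: "continuous_on UNIV clamped_wave"
  unfolding clamped_wave_def by (intro continuous_intros)

lemma clamped_wave_bounds: "0 \<le> clamped_wave t" "clamped_wave t \<le> 1"
  by (auto simp: clamped_wave_def)

text \<open>Within 1/3 of an even integer the cosine is at least 1/2, and within 1/3 of an odd one
  it is at most -1/2; the clamping turns both ranges into constants. Hence a leading ternary digit 0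
  or 2 is read off as 0 or 1.\<close>

lemma clamped_wave_digit:
  fixes n :: int and a :: nat
  assumes "0 \<le> s" "s \<le> 1 / 3" "a \<le> 1"
  shows "clamped_wave (2 * of_int n + 2 * real a / 3 + s) = real a"
proof -
  have per: "cos (pi * (2 * of_int n + w)) = cos (pi * w)" for w
  proof -
    have "pi * (2 * of_int n + w) = pi * w + 2 * pi * of_int n" by (simp add: algebra_simps)
    then show ?thesis by (simp only: cos_add sin_int_2pin cos_int_2pin)
  qed
  consider "a = 0" | "a = 1" using assms by linarith
  then show ?thesis
  proof cases
    case 1
    have "cos (pi * s) \<ge> cos (pi / 3)"
      using assms mult_left_mono[of s "1/3" pi] by (intro cos_monotone_0_pi_le) auto
    with 1 show ?thesis
      using per[of s] by (simp add: clamped_wave_def cos_60)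
  next
    case 2
    have "cos (pi * (2 / 3 + s)) \<le> cos (pi * (2 / 3))"
      using assms mult_left_mono[of "2/3 + s" 1 pi]
      by (intro cos_monotone_0_pi_le) (auto simp: algebra_simps)
    also have "pi * (2 / 3) = pi - pi / 3" by (simp add: field_simps)
    also have "cos (pi - pi / 3) = - 1 / 2"
      by (simp only: cos_pi_minus cos_60)
    finally show ?thesis
      using per[of "2/3 + s"] 2 by (simp add: clamped_wave_def add.assoc)
  qed
qed

text \<open>Here \<open>t\<close> is the Cantor-set point with ternary digits
  \<open>2 * a j\<close>. Scaling by \<open>3 ^ j\<close> brings digit \<open>j\<close> to the
  front, up to an even integer that periodicity removes.\<close>

lemma clamped_wave_cantor:
  fixes a :: "nat \<Rightarrow> nat"
  assumes a: "\<And>j. a j \<le> 1"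
  defines "t \<equiv> (\<Sum>j. 2 * real (a j) / 3 ^ Suc j)"
  shows "0 \<le> t" "t \<le> 1" "\<And>j. clamped_wave (3 ^ j * t) = real (a j)"
proof -
  have geo: "(\<lambda>j. 2 / 3 ^ Suc j :: real) sums 1"
    using sums_mult[OF geometric_sums[of "1/3::real"], of "2/3"] by (simp add: field_simps power_one_over)
  define tail where "tail b = (\<Sum>j. 2 * real (b j) / 3 ^ Suc j)" for b :: "nat \<Rightarrow> nat"
  have summ: "summable (\<lambda>j. 2 * real (b j) / 3 ^ Suc j)" if "\<And>j. b j \<le> 1" for b :: "nat \<Rightarrow> nat"
    by (rule summable_comparison_test[OF _ sums_summable[OF geo]])
       (use that in \<open>auto intro!: exI[of _ 0] divide_right_mono\<close>)
  have tail: "0 \<le> tail b \<and> tail b \<le> 1" if b: "\<And>j. b j \<le> 1" for b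
  proof
    show "0 \<le> tail b" unfolding tail_def by (rule suminf_nonneg[OF summ[OF b]]) auto
    have "tail b \<le> (\<Sum>j. 2 / 3 ^ Suc j)"
      unfolding tail_def
      by (rule suminf_le[OF _ summ[OF b] sums_summable[OF geo]])
         (use b in \<open>auto intro!: divide_right_mono\<close>)
    then show "tail b \<le> 1" using sums_unique[OF geo] by simp
  qed
  have t: "t = tail a" by (simp add: t_def tail_def)
  show "0 \<le> t" "t \<le> 1" using tail[of a] a t by auto
  have split: "tail (\<lambda>i. a (i + j)) = (1/3) * tail (\<lambda>i. a (i + Suc j)) + 2 * real (a j) / 3" for j
  proof -
    have "tail (\<lambda>i. a (i + j)) = (\<Sum>i. 2 * real (a (Suc i + j)) / 3 ^ Suc (Suc i)) + 2 * real (a j) / 3"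
      unfolding tail_def using suminf_split_head[OF summ[of "\<lambda>i. a (i + j)"]] a by simp
    also have "(\<Sum>i. 2 * real (a (Suc i + j)) / 3 ^ Suc (Suc i)) = (1/3) * tail (\<lambda>i. a (i + Suc j))"
      unfolding tail_def using suminf_mult[OF summ[of "\<lambda>i. a (i + Suc j)"], of "1/3"] a by simp
    finally show ?thesis .
  qed
  \<comment> \<open>The digits moved in front of the ternary point are all 0 or 2, so together they
    form an even integer.\<close>
  have shift: "\<exists>n::int. 3 ^ j * t = 2 * of_int n + tail (\<lambda>i. a (i + j))" for j
  proof (induction j)
    case 0 then show ?case by (auto simp: t intro: exI[of _ 0])
  next
    case (Suc j)
    then obtain n :: int where n: "3 ^ j * t = 2 * of_int n + tail (\<lambda>i. a (i + j))" by blast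
    have "3 ^ Suc j * t = 2 * of_int (3 * n + int (a j)) + tail (\<lambda>i. a (i + Suc j))"
      using n split[of j] by simp
    then show ?case by blast
  qed
  show "clamped_wave (3 ^ j * t) = real (a j)" for j
  proof -
    obtain n :: int where n: "3 ^ j * t = 2 * of_int n + tail (\<lambda>i. a (i + j))" using shift by blast
    have "3 ^ j * t = 2 * of_int n + 2 * real (a j) / 3 + (1/3) * tail (\<lambda>i. a (i + Suc j))"
      using n split[of j] by simp
    then show ?thesis
      using clamped_wave_digit[of "(1/3) * tail (\<lambda>i. a (i + Suc j))" "a j" n] tail[of "\<lambda>i. a (i + Suc j)"] a
      by simp
  qed
qed

text \<open>The digits are the increments of the dyadic truncations of \<open>x\<close>, whose error
  at level \<open>n\<close> is less than \<open>1 / 2 ^ n\<close>.\<close>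

lemma binary_expansion:
  fixes x :: real
  assumes "0 \<le> x" "x < 1"
  obtains a :: "nat \<Rightarrow> nat" where "\<And>k. a k \<le> 1" and "(\<lambda>k. real (a k) / 2 ^ Suc k) sums x"
proof -
  define fl where "fl n = nat \<lfloor>2 ^ n * x\<rfloor>" for n
  \<comment> \<open>This is subtraction of naturals; \<open>step\<close> shows that it never
    truncates and yields only 0 or 1.\<close>
  define a where "a k = fl (Suc k) - 2 * fl k" for k
  have fl: "real (fl n) \<le> 2 ^ n * x" "2 ^ n * x < real (fl n) + 1" for n
    using assms by (auto simp: fl_def)
  have step: "2 * fl k \<le> fl (Suc k)" "fl (Suc k) \<le> 2 * fl k + 1" for k
  proof -
    have "real (2 * fl k) < real (fl (Suc k) + 1)" "real (fl (Suc k)) < real (2 * fl k + 2)"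
      using fl[of k] fl[of "Suc k"] by auto
    then show "2 * fl k \<le> fl (Suc k)" "fl (Suc k) \<le> 2 * fl k + 1"
      unfolding of_nat_less_iff by linarith+
  qed
  \<comment> \<open>The partial sums telescope. The start \<open>fl 0 = 0\<close> is where
    \<open>x < 1\<close> enters.\<close>
  have sum: "(\<Sum>k<n. real (a k) / 2 ^ Suc k) = real (fl n) / 2 ^ n" for n
  proof (induction n)
    case 0 then show ?case using assms by (simp add: fl_def floor_eq_iff)
  next
    case (Suc n)
    have "real (a n) = real (fl (Suc n)) - 2 * real (fl n)"
      using step[of n] by (simp add: a_def of_nat_diff)
    with Suc show ?case by (simp add: field_simps)
  qed
  have "(\<lambda>n. x - 1 / 2 ^ n) \<longlonglongrightarrow> x - 0"
    by (intro tendsto_intros) (use LIMSEQ_power_zero[of "1/2::real"] in \<open>simp add: power_one_over\<close>)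
  then have lower: "(\<lambda>n. x - 1 / 2 ^ n) \<longlonglongrightarrow> x" by simp
  have "(\<lambda>n. real (fl n) / 2 ^ n) \<longlonglongrightarrow> x"
  proof (rule tendsto_sandwich[OF _ _ lower tendsto_const])
    show "\<forall>\<^sub>F n in sequentially. x - 1 / 2 ^ n \<le> real (fl n) / 2 ^ n"
    proof (intro always_eventually allI)
      fix n
      have "x - 1 / 2 ^ n = (2 ^ n * x - 1) / 2 ^ n" by (simp add: field_simps)
      also have "\<dots> \<le> real (fl n) / 2 ^ n" using fl(2)[of n] by (intro divide_right_mono) auto
      finally show "x - 1 / 2 ^ n \<le> real (fl n) / 2 ^ n" .
    qed
    show "\<forall>\<^sub>F n in sequentially. real (fl n) / 2 ^ n \<le> x"
      using fl(1) by (intro always_eventually allI) (simp add: field_simps)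
  qed
  then have "(\<lambda>k. real (a k) / 2 ^ Suc k) sums x"
    unfolding sums_def sum .
  moreover have "a k \<le> 1" for k using step[of k] by (simp add: a_def)
  ultimately show thesis using that by blast
qed

text \<open>A variant of Schoenberg's space-filling curve: the ternary digits of the parameter
  are the binary digits of the coordinates, dealt out cyclically.\<close>

lemma compact_covered_by_curve:
  fixes K :: "'a::euclidean_space set"
  assumes "compact K"
  obtains g :: "real \<Rightarrow> 'a" where "continuous_on UNIV g" "K \<subseteq> g ` {0..1}"
proof -
  obtain R where R: "R > 0" "\<And>z. z \<in> K \<Longrightarrow> norm z < R"
    using compact_imp_bounded[OF assms] unfolding bounded_pos_less by blast
  define N where "N = DIM('a)"
  have "N > 0" by (simp add: N_def)
  obtain e :: "'a \<Rightarrow> nat" where e: "bij_betw e Basis {0..<N}"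
    unfolding N_def using ex_bij_betw_finite_nat[OF finite_Basis] by blast
  \<comment> \<open>Coordinate \<open>i\<close> owns the ternary positions congruent to
    \<open>i\<close> modulo \<open>N\<close> and reads them as binary digits.\<close>
  define coord where "coord i t = (\<Sum>k. clamped_wave (3 ^ (N * k + i) * t) / 2 ^ Suc k)" for i t
  have geo: "summable (\<lambda>k. 1 / 2 ^ Suc k :: real)"
    using summable_mult[OF summable_geometric[of "1/2::real"], of "1/2"] by (simp add: power_one_over)
  have coord_cont: "continuous_on UNIV (coord i)" for i
  proof -
    have "uniform_limit UNIV (\<lambda>n t. \<Sum>k<n. clamped_wave (3 ^ (N * k + i) * t) / 2 ^ Suc k) (coord i) sequentially"
      unfolding coord_def
      by (rule Weierstrass_m_test[OF _ geo])
         (auto simp: clamped_wave_bounds intro!: divide_right_mono)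
    moreover have "continuous_on UNIV (\<lambda>t. \<Sum>k<n. clamped_wave (3 ^ (N * k + i) * t) / 2 ^ Suc k)" for n
      by (intro continuous_intros continuous_on_compose2[OF continuous_clamped_wave]) auto
    ultimately show ?thesis
      by (intro uniform_limit_theorem) auto
  qed
  \<comment> \<open>An affine map takes the unit cube onto the cube with side \<open>2 * R\<close>
    centered at the origin, which contains \<open>K\<close>.\<close>
  define g where "g t = (\<Sum>b\<in>Basis. (2 * R * coord (e b) t - R) *\<^sub>R b)" for t :: real
  have "continuous_on UNIV g"
    unfolding g_def by (intro continuous_intros coord_cont)
  moreover have "z \<in> g ` {0..1}" if "z \<in> K" for z
  proof -
    \<comment> \<open>The strict bound \<open>norm z < R\<close> keeps the rescaled coordinates
      below 1, as the binary expansion requires.\<close>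
    have x: "0 \<le> (z \<bullet> b + R) / (2 * R)" "(z \<bullet> b + R) / (2 * R) < 1" if "b \<in> Basis" for b
      using Basis_le_norm[OF that, of z] R(1) R(2)[OF \<open>z \<in> K\<close>] by (auto simp: field_simps abs_le_iff)
    have "\<exists>a::nat \<Rightarrow> nat. (\<forall>k. a k \<le> 1) \<and> (\<lambda>k. real (a k) / 2 ^ Suc k) sums ((z \<bullet> b + R) / (2 * R))"
      if "b \<in> Basis" for b
      using binary_expansion[OF x[OF that]] by metis
    then obtain A :: "'a \<Rightarrow> nat \<Rightarrow> nat"
      where A: "\<And>b k. b \<in> Basis \<Longrightarrow> A b k \<le> 1"
        "\<And>b. b \<in> Basis \<Longrightarrow> (\<lambda>k. real (A b k) / 2 ^ Suc k) sums ((z \<bullet> b + R) / (2 * R))"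
      by metis
    \<comment> \<open>Position \<open>j\<close> carries digit \<open>j div N\<close> of the
      coordinate numbered \<open>j mod N\<close>, matching the positions read by
      \<open>coord\<close>.\<close>
    define d where "d j = A (inv_into Basis e (j mod N)) (j div N)" for j
    have d_le: "d j \<le> 1" for j
    proof -
      have "inv_into Basis e (j mod N) \<in> Basis"
        using e \<open>N > 0\<close> by (intro inv_into_into) (auto simp: bij_betw_def)
      then show ?thesis unfolding d_def by (rule A(1))
    qed
    define t where "t = (\<Sum>j. 2 * real (d j) / 3 ^ Suc j)"
    note t = clamped_wave_cantor[of d, OF d_le, folded t_def]
    have "coord (e b) t = (z \<bullet> b + R) / (2 * R)" if b: "b \<in> Basis" for b
    proof -
      have "e b < N" using e b by (auto simp: bij_betw_def)
      then have "d (N * k + e b) = A b k" for k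
        using b e by (simp add: d_def bij_betw_def)
      then show ?thesis
        unfolding coord_def t(3) using A(2)[OF b] by (simp add: sums_iff)
    qed
    then have "g t = (\<Sum>b\<in>Basis. (z \<bullet> b) *\<^sub>R b)"
      unfolding g_def using R(1) by (intro sum.cong) (auto simp: field_simps)
    then have "g t = z" by (simp add: euclidean_representation)
    then show ?thesis using t(1,2) by force
  qed
  ultimately show thesis using that by blast
qed

section \<open>Weak compactness\<close>

lemma borel_prob_onD:
  assumes "borel_prob_on K M"
  shows "prob_space M" "sets M = sets borel" "space M = UNIV" "emeasure M K = 1" "K \<in> sets borel" "AE z in M. z \<in> K"
proof -
  show M: "prob_space M" "sets M = sets borel" "emeasure M K = 1"
    using assms by (auto simp: borel_prob_on_def)
  show sp: "space M = UNIV" using sets_eq_imp_space_eq[OF M(2)] by simp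
  \<comment> \<open>A set outside the sigma-algebra has \<open>emeasure\<close> 0, so full mass
    forces measurability.\<close>
  show K: "K \<in> sets borel" using M emeasure_notin_sets[of K M] by force
  interpret prob_space M by fact
  show "AE z in M. z \<in> K" using M K by (subst AE_in_set_eq_1) (auto simp: measure_def)
qed

lemma borel_prob_onI:
  assumes "prob_space M" "sets M = sets borel" "K \<in> sets borel" "AE z in M. z \<in> K"
  shows "borel_prob_on K M"
proof -
  interpret prob_space M by fact
  show ?thesis
    using assms AE_in_set_eq_1[of K] by (auto simp: borel_prob_on_def emeasure_eq_measure)
qed

lemma borel_prob_on_integrable_continuous:
  fixes f :: "'a::euclidean_space \<Rightarrow> real"
  assumes K: "compact K" and M: "borel_prob_on K M" and f: "continuous_on UNIV f"
  shows "integrable M f"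
proof -
  note M = borel_prob_onD[OF M]
  interpret prob_space M by (rule M)
  have "bounded (f ` K)"
    using K f by (intro compact_imp_bounded compact_continuous_image) (auto intro: continuous_on_subset)
  then obtain B where B: "\<And>z. z \<in> K \<Longrightarrow> norm (f z) \<le> B" by (auto simp: bounded_iff)
  show ?thesis
  proof (rule integrable_const_bound[where B=B])
    show "AE z in M. norm (f z) \<le> B" using M(6) by eventually_elim (rule B)
    show "f \<in> borel_measurable M"
      unfolding measurable_cong_sets[OF M(2) refl] by (rule borel_measurable_continuous_onI[OF f])
  qed
qed

lemma borel_prob_on_integral_abs_le:
  fixes f :: "'a::euclidean_space \<Rightarrow> real"
  assumes K: "compact K" and M: "borel_prob_on K M" and f: "continuous_on UNIV f"
    and B: "\<And>z. z \<in> K \<Longrightarrow> \<bar>f z\<bar> \<le> B"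
  shows "\<bar>integral\<^sup>L M f\<bar> \<le> B"
proof -
  note int = borel_prob_on_integrable_continuous[OF K M f]
  note M = borel_prob_onD[OF M]
  interpret prob_space M by (rule M)
  have "\<bar>integral\<^sup>L M f\<bar> \<le> (\<integral>z. \<bar>f z\<bar> \<partial>M)" by (rule integral_abs_bound)
  also have "\<dots> \<le> (\<integral>z. B \<partial>M)"
    using int M(6) by (intro integral_mono_AE) (auto elim!: eventually_mono intro: B)
  finally show ?thesis by (simp add: prob_space)
qed

text \<open>Realised as the law of a coin experiment: with probability \<open>t\<close> return
  \<open>z\<close>, otherwise a sample of \<open>M\<close>. These are the perturbations towards
  point masses used in the first-order condition below.\<close>

lemma borel_prob_on_mixture:
  fixes M :: "'a::euclidean_space measure"
  assumes K: "compact K" and M: "borel_prob_on K M" and z: "z \<in> K" and t: "0 \<le> t" "t \<le> 1"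
  obtains M' where "borel_prob_on K M'"
    and "\<And>f :: 'a \<Rightarrow> real. continuous_on UNIV f \<Longrightarrow> integral\<^sup>L M' f = (1 - t) * integral\<^sup>L M f + t * f z"
proof -
  note M' = borel_prob_onD[OF M]
  note [measurable_cong] = M'(2)
  interpret M: prob_space M by (rule M')
  define P where "P = measure_pmf (bernoulli_pmf t) \<Otimes>\<^sub>M M"
  interpret B: prob_space "measure_pmf (bernoulli_pmf t)" by (rule prob_space_measure_pmf)
  interpret P: pair_prob_space "measure_pmf (bernoulli_pmf t)" M ..
  define h where "h = (\<lambda>(b, w). if b then z else w)"
  have h[measurable]: "h \<in> borel_measurable P"
    unfolding h_def P_def by measurable
  have [measurable]: "K \<in> sets borel" by (rule M')
  define M' where "M' = distr P borel h"
  have "prob_space M'"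
    unfolding M'_def P_def by (rule P.prob_space_distr) (use h in \<open>simp add: P_def\<close>)
  moreover have "AE w in M'. w \<in> K"
  proof -
    have "AE x in P. h x \<in> K"
      unfolding P_def
    proof (rule P.AE_pair_measure)
      show "{x \<in> space (measure_pmf (bernoulli_pmf t) \<Otimes>\<^sub>M M). h x \<in> K} \<in> sets (measure_pmf (bernoulli_pmf t) \<Otimes>\<^sub>M M)"
        unfolding P_def[symmetric] by measurable
      show "AE x in measure_pmf (bernoulli_pmf t). AE y in M. h (x, y) \<in> K"
        using borel_prob_onD(6)[OF M] z by (auto simp: h_def)
    qed
    then show ?thesis
      unfolding M'_def by (subst AE_distr_iff) auto
  qed
  ultimately have bp: "borel_prob_on K M'"
    by (intro borel_prob_onI) (auto simp: M'_def)
  show thesis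
  proof (rule that[OF bp])
    fix f :: "'a \<Rightarrow> real" assume f: "continuous_on UNIV f"
    have [measurable]: "f \<in> borel_measurable borel" by (rule borel_measurable_continuous_onI[OF f])
    have int: "integrable P (\<lambda>x. f (h x))"
      using borel_prob_on_integrable_continuous[OF K bp f]
      unfolding M'_def by (subst (asm) integrable_distr_eq) auto
    have "integral\<^sup>L M' f = (\<integral>x. f (h x) \<partial>P)"
      unfolding M'_def by (rule integral_distr) auto
    also have "\<dots> = (\<integral>b. (\<integral>w. f (h (b, w)) \<partial>M) \<partial>measure_pmf (bernoulli_pmf t))"
      using P.integral_fst'[OF int[unfolded P_def]] by (simp add: P_def)
    also have "\<dots> = (1 - t) * integral\<^sup>L M f + t * f z"
      using t by (simp add: h_def M.prob_space)
    finally show "integral\<^sup>L M' f = (1 - t) * integral\<^sup>L M f + t * f z" .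
  qed
qed

text \<open>The curve covering \<open>K\<close> reduces weak sequential compactness to Helly's selection theorem
  on the line: \<open>h\<close> below is a Borel right inverse of the curve.\<close>

lemma borel_prob_on_seq_compact:
  fixes K :: "'a::euclidean_space set" and \<theta> :: "nat \<Rightarrow> 'a measure"
  assumes K: "compact K" and \<theta>: "\<And>n. borel_prob_on K (\<theta> n)"
  obtains s \<theta>' where "strict_mono (s :: nat \<Rightarrow> nat)" and "borel_prob_on K \<theta>'"
    and "\<And>f :: 'a \<Rightarrow> real. continuous_on UNIV f \<Longrightarrow> (\<lambda>n. integral\<^sup>L (\<theta> (s n)) f) \<longlonglongrightarrow> integral\<^sup>L \<theta>' f"
proof -
  note \<theta>D = borel_prob_onD[OF \<theta>]
  obtain g0 :: "real \<Rightarrow> 'a" where g0: "continuous_on UNIV g0" "K \<subseteq> g0 ` {0..1}"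
    using compact_covered_by_curve[OF K] by blast
  \<comment> \<open>Clamping the parameter makes every continuous \<open>f\<close> bounded along the
    whole curve, so that \<open>f\<close> composed with \<open>g\<close> is an admissible test
    function for weak convergence on the line.\<close>
  define g where "g t = g0 (max 0 (min 1 t))" for t
  have g_cont: "continuous_on UNIV g"
    unfolding g_def by (intro continuous_on_compose2[OF g0(1)] continuous_intros) auto
  have g_eq: "g t = g0 t" if "t \<in> {0..1}" for t using that by (simp add: g_def)
  have g_sub: "K \<subseteq> g ` {0..1}" using g0(2) g_eq by (metis image_cong)
  have [measurable]: "g \<in> borel_measurable borel" by (rule borel_measurable_continuous_onI[OF g_cont])
  define T where "T z = {0..1} \<inter> g -` {z}" for z
  have T_closed: "closed (T z)" for z
    unfolding T_def by (intro closed_Int closed_vimage continuous_on_subset[OF g_cont]) auto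
  have T_ne: "T z \<noteq> {}" if "z \<in> K" for z using g_sub that by (auto simp: T_def)
  have T_bdd: "bdd_below (T z)" for z by (rule bdd_belowI[of _ 0]) (auto simp: T_def)
  \<comment> \<open>The first parameter in the unit interval at which the curve hits
    \<open>z\<close>; the value 0 off \<open>K\<close> is a default that stays in the
    interval.\<close>
  define h where "h z = (if z \<in> K then Inf (T z) else 0)" for z
  have h_T: "h z \<in> T z" if "z \<in> K" for z
    using closed_contains_Inf[OF T_ne[OF that] T_bdd T_closed] that by (simp add: h_def)
  have gh: "g (h z) = z" if "z \<in> K" for z using h_T[OF that] by (simp add: T_def)
  have h_01: "0 \<le> h z" "h z \<le> 1" for z
    using h_T[of z] by (cases "z \<in> K"; auto simp: T_def h_def)+
  have K_borel[measurable]: "K \<in> sets borel" using K by (simp add: borel_compact)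
  \<comment> \<open>Since the infimum is attained, a point of \<open>K\<close> has first hitting
    parameter at most \<open>a\<close> exactly when it is hit by time \<open>a\<close>. Sublevel
    sets are therefore built from \<open>K\<close>, a compact image and possibly the complement of
    \<open>K\<close>, which makes \<open>h\<close> Borel.\<close>
  have h_le: "{z. h z \<le> a} = (K \<inter> g ` ({0..1} \<inter> {..a})) \<union> (if 0 \<le> a then - K else {})" for a
  proof (intro set_eqI iffI)
    fix z assume z: "z \<in> {z. h z \<le> a}"
    show "z \<in> (K \<inter> g ` ({0..1} \<inter> {..a})) \<union> (if 0 \<le> a then - K else {})"
    proof (cases "z \<in> K")
      case True
      then have "h z \<in> {0..1} \<inter> {..a}" "g (h z) = z" using z h_01 gh by auto
      with True show ?thesis by (metis Int_iff UnI1 image_eqI)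
    next
      case False then show ?thesis using z by (auto simp: h_def)
    qed
  next
    fix z assume z: "z \<in> (K \<inter> g ` ({0..1} \<inter> {..a})) \<union> (if 0 \<le> a then - K else {})"
    show "z \<in> {z. h z \<le> a}"
    proof (cases "z \<in> K")
      case True
      then obtain t where "t \<in> T z" "t \<le> a" using z by (auto simp: T_def split: if_splits)
      then have "Inf (T z) \<le> a" using cInf_lower[OF _ T_bdd] by force
      then show ?thesis using True by (simp add: h_def)
    next
      case False then show ?thesis using z by (auto simp: h_def split: if_splits)
    qed
  qed
  have h_meas[measurable]: "h \<in> borel_measurable borel"
  proof (rule borel_measurableI_le)
    fix a
    have "compact (g ` ({0..1} \<inter> {..a}))"
      by (intro compact_continuous_image continuous_on_subset[OF g_cont] compact_Int_closed) auto
    then have "{z. h z \<le> a} \<in> sets borel"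
      unfolding h_le by (auto intro!: sets.Un sets.Int simp: borel_compact)
    then show "{z \<in> space borel. h z \<le> a} \<in> sets borel" by simp
  qed
  have h_meas': "h \<in> borel_measurable (\<theta> n)" for n
    using h_meas unfolding measurable_cong_sets[OF \<theta>D(2) refl] .
  define \<Lambda> where "\<Lambda> n = distr (\<theta> n) borel h" for n
  have \<Lambda>: "real_distribution (\<Lambda> n)" for n
    unfolding \<Lambda>_def real_distribution_def real_distribution_axioms_def
    using prob_space.prob_space_distr[OF \<theta>D(1) h_meas'] by auto
  \<comment> \<open>Tightness is stated with half-open intervals, so the left end lies strictly
    below 0.\<close>
  have "measure (\<Lambda> n) {-1<..1} = 1" for n
  proof -
    have "-1 < h z" for z using h_01(1)[of z] by linarith
    then have "h -` {-1<..1} = UNIV" using h_01 by auto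
    then show ?thesis
      unfolding \<Lambda>_def using prob_space.prob_space[OF \<theta>D(1)[of n]]
      by (subst measure_distr[OF h_meas']) (auto simp: \<theta>D(3))
  qed
  then have "tight \<Lambda>"
    unfolding tight_def using \<Lambda> by (intro conjI allI impI exI[of _ "-1"] exI[of _ 1]) auto
  then obtain s M where s: "strict_mono (s :: nat \<Rightarrow> nat)" and M: "real_distribution M"
    and wc: "weak_conv_m (\<Lambda> \<circ> id \<circ> s) M"
    using tight_imp_convergent_subsubsequence[of \<Lambda> id] by (auto simp: strict_mono_def)
  interpret M: real_distribution M by fact
  define \<theta>' where "\<theta>' = distr M borel g"
  have conv: "(\<lambda>n. integral\<^sup>L (\<theta> (s n)) f) \<longlonglongrightarrow> integral\<^sup>L \<theta>' f"
    and bdd: "integrable \<theta>' f"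
    if f: "continuous_on UNIV f" for f :: "'a \<Rightarrow> real"
  proof -
    have [measurable]: "f \<in> borel_measurable borel" by (rule borel_measurable_continuous_onI[OF f])
    have "bounded ((\<lambda>t. f (g0 t)) ` {0..1})"
      by (intro compact_imp_bounded compact_continuous_image continuous_on_compose2[OF f]
            continuous_on_subset[OF g0(1)]) auto
    then obtain B where "\<And>t. t \<in> {0..1} \<Longrightarrow> norm (f (g0 t)) \<le> B" unfolding bounded_iff by blast
    then have B: "norm (f (g t)) \<le> B" for t by (auto simp: g_def)
    have fg: "continuous_on UNIV (\<lambda>t. f (g t))"
      by (intro continuous_on_compose2[OF f g_cont]) auto
    show "integrable \<theta>' f"
      unfolding \<theta>'_def
      by (subst integrable_distr_eq) (auto intro!: M.integrable_const_bound[where B=B] B)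
    have "(\<lambda>n. integral\<^sup>L ((\<Lambda> \<circ> id \<circ> s) n) (\<lambda>t. f (g t))) \<longlonglongrightarrow> integral\<^sup>L M (\<lambda>t. f (g t))"
      using fg B \<Lambda> by (intro weak_conv_imp_integral_bdd_continuous_conv[OF _ M wc, where B=B])
        (auto simp: continuous_on_eq_continuous_at)
    also have "integral\<^sup>L M (\<lambda>t. f (g t)) = integral\<^sup>L \<theta>' f"
      unfolding \<theta>'_def by (rule integral_distr[symmetric]) auto
    \<comment> \<open>Lifting by \<open>h\<close> and projecting by \<open>g\<close> is the identity
      on \<open>K\<close>, hence almost everywhere.\<close>
    also have "(\<lambda>n. integral\<^sup>L ((\<Lambda> \<circ> id \<circ> s) n) (\<lambda>t. f (g t))) = (\<lambda>n. integral\<^sup>L (\<theta> (s n)) f)"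
    proof
      fix n
      have "integral\<^sup>L ((\<Lambda> \<circ> id \<circ> s) n) (\<lambda>t. f (g t)) = (\<integral>z. f (g (h z)) \<partial>\<theta> (s n))"
        unfolding \<Lambda>_def comp_def id_def by (rule integral_distr[OF h_meas']) auto
      also have "\<dots> = integral\<^sup>L (\<theta> (s n)) f"
      proof (rule integral_cong_AE)
        show "AE z in \<theta> (s n). f (g (h z)) = f z"
          using \<theta>D(6)[of "s n"] by eventually_elim (simp add: gh)
      qed (simp_all add: measurable_cong_sets[OF \<theta>D(2) refl])
      finally show "integral\<^sup>L ((\<Lambda> \<circ> id \<circ> s) n) (\<lambda>t. f (g t)) = integral\<^sup>L (\<theta> (s n)) f" .
    qed
    finally show "(\<lambda>n. integral\<^sup>L (\<theta> (s n)) f) \<longlonglongrightarrow> integral\<^sup>L \<theta>' f" .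
  qed
  have "K \<noteq> {}" using \<theta>D(4)[of 0] by auto
  \<comment> \<open>The distance to \<open>K\<close> is itself a test function: its integrals vanish
    along the sequence, hence in the limit, and so the limit measure is carried by the closed set
    \<open>K\<close>.\<close>
  have dist_cont: "continuous_on UNIV (\<lambda>z. infdist z K)" by (intro continuous_intros)
  have "integral\<^sup>L (\<theta> (s n)) (\<lambda>z. infdist z K) = 0" for n
    by (rule integral_eq_zero_AE) (use \<theta>D(6)[of "s n"] in \<open>auto elim!: eventually_mono\<close>)
  then have "integral\<^sup>L \<theta>' (\<lambda>z. infdist z K) = 0"
    using conv[OF dist_cont] by (simp add: LIMSEQ_const_iff)
  then have "AE z in \<theta>'. infdist z K = 0"
    by (subst (asm) integral_nonneg_eq_0_iff_AE[OF bdd[OF dist_cont]]) (auto simp: infdist_nonneg)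
  then have "AE z in \<theta>'. z \<in> K"
    by eventually_elim (use in_closed_iff_infdist_zero[OF compact_imp_closed[OF K] \<open>K \<noteq> {}\<close>] in auto)
  moreover have "prob_space \<theta>'" unfolding \<theta>'_def by (rule M.prob_space_distr) auto
  ultimately have "borel_prob_on K \<theta>'"
    by (intro borel_prob_onI) (auto simp: \<theta>'_def)
  then show thesis using that s conv by blast
qed

section \<open>A theorem of the alternative for moment problems\<close>

text \<open>The separating functional is the gradient of the squared defect at its minimiser, tested
  against point masses.\<close>

lemma moment_alternative:
  fixes K :: "'a::euclidean_space set" and f :: "nat \<Rightarrow> 'a \<Rightarrow> real" and c :: "'a \<Rightarrow> real"
  assumes K: "compact K" and ne: "borel_prob_on K \<theta>\<^sub>0"
    and f: "\<And>i. continuous_on UNIV (f i)" and f_le: "\<And>i z. \<bar>f i z\<bar> \<le> (1 / 2) ^ i"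
    and c: "continuous_on UNIV c"
  shows "(\<exists>\<theta>. borel_prob_on K \<theta> \<and> (\<forall>i. integral\<^sup>L \<theta> (f i) = 0) \<and> 0 \<le> integral\<^sup>L \<theta> c) \<or>
    (\<exists>\<rho> \<kappa> \<eta>. (\<forall>i. \<bar>\<rho> i\<bar> \<le> 1) \<and> 0 \<le> \<kappa> \<and> 0 < \<eta> \<and> (\<forall>z\<in>K. (\<Sum>i. \<rho> i * f i z) + \<kappa> * c z \<le> - \<eta>))"
proof -
  \<comment> \<open>The positive part penalises only a violation of the inequality for
    \<open>c\<close>, while the equations are penalised in both directions.\<close>
  define J where "J \<theta> = (\<Sum>i. (integral\<^sup>L \<theta> (f i))\<^sup>2) + (max 0 (- integral\<^sup>L \<theta> c))\<^sup>2" for \<theta>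
  define W where "W = Collect (borel_prob_on K)"
  have geo: "summable (\<lambda>i. B * (1 / 2) ^ i :: real)" for B
    by (intro summable_mult summable_geometric) auto
  have int_le: "\<bar>integral\<^sup>L \<theta> (f i)\<bar> \<le> (1 / 2) ^ i" if "borel_prob_on K \<theta>" for \<theta> i
    by (rule borel_prob_on_integral_abs_le[OF K that f f_le])
  have half_le: "(1 / 2 :: real) ^ i \<le> 1" for i by (simp add: power_le_one)
  have sq_le: "norm ((integral\<^sup>L \<theta> (f i))\<^sup>2) \<le> 1 * (1 / 2) ^ i" if "borel_prob_on K \<theta>" for \<theta> i
  proof -
    have "\<bar>integral\<^sup>L \<theta> (f i)\<bar> * \<bar>integral\<^sup>L \<theta> (f i)\<bar> \<le> 1 * (1 / 2) ^ i"
      using int_le[OF that, of i] half_le[of i] by (intro mult_mono) auto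
    then show ?thesis by (simp add: power2_eq_square abs_mult)
  qed
  have J_nonneg: "0 \<le> J \<theta>" if "borel_prob_on K \<theta>" for \<theta>
    unfolding J_def
    by (intro add_nonneg_nonneg suminf_nonneg summable_comparison_test'[OF geo sq_le[OF that]]) auto
  have bdd: "bdd_below (J ` W)"
    by (rule bdd_belowI[of _ 0]) (auto simp: W_def J_nonneg)
  have "J ` W \<noteq> {}" using ne by (auto simp: W_def)
  have "\<exists>\<theta>. borel_prob_on K \<theta> \<and> J \<theta> < Inf (J ` W) + 1 / real (Suc n)" for n
    using cInf_lessD[OF \<open>J ` W \<noteq> {}\<close>, of "Inf (J ` W) + 1 / real (Suc n)"] by (auto simp: W_def)
  then obtain \<theta>n where \<theta>n: "\<And>n. borel_prob_on K (\<theta>n n)"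
    "\<And>n. J (\<theta>n n) < Inf (J ` W) + 1 / real (Suc n)" by metis
  obtain s \<theta> where s: "strict_mono s" and \<theta>: "borel_prob_on K \<theta>"
    and conv: "\<And>f :: 'a \<Rightarrow> real. continuous_on UNIV f \<Longrightarrow> (\<lambda>n. integral\<^sup>L (\<theta>n (s n)) f) \<longlonglongrightarrow> integral\<^sup>L \<theta> f"
    by (rule borel_prob_on_seq_compact[of K \<theta>n, OF K \<theta>n(1)]) (rule that)
  \<comment> \<open>The bound \<open>(1 / 2) ^ i\<close> is uniform in \<open>n\<close>, so
    Tannery's theorem exchanges limit and sum. Thus \<open>J\<close> converges along the subsequence
    and its infimum is attained at \<open>\<theta>\<close>.\<close>
  have "(\<lambda>n. \<Sum>i. (integral\<^sup>L (\<theta>n (s n)) (f i))\<^sup>2) \<longlonglongrightarrow> (\<Sum>i. (integral\<^sup>L \<theta> (f i))\<^sup>2)"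
    using tannerys_theorem[of "\<lambda>i n. (integral\<^sup>L (\<theta>n (s n)) (f i))\<^sup>2" _ sequentially, OF tendsto_power[OF conv[OF f]] _ geo[of 1]]
      sq_le[OF \<theta>n(1)]
    by (auto simp: case_prod_unfold)
  then have "(\<lambda>n. J (\<theta>n (s n))) \<longlonglongrightarrow> J \<theta>"
    unfolding J_def by (intro tendsto_intros conv c)
  moreover have "(\<lambda>n. Inf (J ` W) + 1 / real (Suc (s n))) \<longlonglongrightarrow> Inf (J ` W) + 0"
    by (intro tendsto_intros LIMSEQ_subseq_LIMSEQ[OF _ s, unfolded comp_def]
          LIMSEQ_inverse_real_of_nat[unfolded inverse_eq_divide])
  ultimately have "J \<theta> \<le> Inf (J ` W) + 0"
    by (rule LIMSEQ_le) (use \<theta>n(2) less_imp_le in blast)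
  then have J_min: "J \<theta> \<le> J \<theta>'" if "borel_prob_on K \<theta>'" for \<theta>'
    using cInf_lower[OF _ bdd, of "J \<theta>'"] that by (auto simp: W_def)
  define r where "r i = integral\<^sup>L \<theta> (f i)" for i
  define q where "q = max 0 (- integral\<^sup>L \<theta> c)"
  have r_le: "\<bar>r i\<bar> \<le> (1 / 2) ^ i" for i unfolding r_def by (rule int_le[OF \<theta>])
  have r_le1: "\<bar>r i\<bar> \<le> 1" for i using r_le[of i] half_le[of i] by linarith
  have J_eq: "J \<theta> = (\<Sum>i. (r i)\<^sup>2) + q\<^sup>2" by (simp add: J_def r_def q_def)
  have sum_r2: "summable (\<lambda>i. (r i)\<^sup>2)"
    unfolding r_def by (rule summable_comparison_test'[OF geo sq_le[OF \<theta>]])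
  have key: "(\<Sum>i. - r i * f i z) + q * c z \<le> - J \<theta>" if z: "z \<in> K" for z
  proof -
    \<comment> \<open>Moving from \<open>\<theta>\<close> towards the point mass at \<open>z\<close>
      changes the moment of \<open>f i\<close> at rate \<open>d i\<close>, and the bound for the
      defect of \<open>c\<close> at rate \<open>e\<close>.\<close>
    define d where "d i = f i z - r i" for i
    define e where "e = - c z - q"
    have d_le: "\<bar>d i\<bar> \<le> 2 * (1 / 2) ^ i" for i
      using f_le[of i z] r_le[of i] by (auto simp: d_def)
    have d_le2: "\<bar>d i\<bar> \<le> 2" for i using d_le[of i] half_le[of i] by linarith
    have sum_rf: "summable (\<lambda>i. r i * f i z)"
    proof (rule summable_comparison_test'[OF geo[of 1]])
      show "norm (r i * f i z) \<le> 1 * (1 / 2) ^ i" for i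
        unfolding real_norm_def abs_mult by (intro mult_mono r_le1 f_le) auto
    qed
    have rd_eq: "r i * d i = r i * f i z - (r i)\<^sup>2" for i by (simp add: d_def algebra_simps power2_eq_square)
    have sum_rd: "summable (\<lambda>i. r i * d i)"
      unfolding rd_eq by (intro summable_diff sum_rf sum_r2)
    have sum_d2: "summable (\<lambda>i. (d i)\<^sup>2)"
    proof (rule summable_comparison_test'[OF geo[of 4]])
      fix i
      have "\<bar>d i\<bar> * \<bar>d i\<bar> \<le> 2 * (2 * (1 / 2) ^ i)" by (intro mult_mono d_le d_le2) auto
      then show "norm ((d i)\<^sup>2) \<le> 4 * (1 / 2) ^ i" by (simp add: power2_eq_square abs_mult)
    qed
    \<comment> \<open>\<open>2 * A\<close> and \<open>C\<close> are the linear and quadratic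
      coefficients in \<open>t\<close> of the upper bound for \<open>J\<close> along the
      mixture.\<close>
    define A where "A = (\<Sum>i. r i * d i) + q * e"
    define C where "C = (\<Sum>i. (d i)\<^sup>2) + e\<^sup>2"
    have quad: "0 \<le> 2 * A + t * C" if t: "0 < t" "t \<le> 1" for t
    proof -
      obtain M where M: "borel_prob_on K M"
        and M_int: "\<And>g :: 'a \<Rightarrow> real. continuous_on UNIV g \<Longrightarrow> integral\<^sup>L M g = (1 - t) * integral\<^sup>L \<theta> g + t * g z"
        using borel_prob_on_mixture[OF K \<theta> z, of t] t by auto
      have "integral\<^sup>L M (f i) = r i + t * d i" for i
        by (simp add: M_int[OF f] r_def d_def algebra_simps)
      then have "(\<Sum>i. (integral\<^sup>L M (f i))\<^sup>2) = (\<Sum>i. (r i)\<^sup>2 + (2 * t) * (r i * d i) + t\<^sup>2 * (d i)\<^sup>2)"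
        by (simp add: power2_eq_square algebra_simps)
      also have "\<dots> = (\<Sum>i. (r i)\<^sup>2) + (2 * t) * (\<Sum>i. r i * d i) + t\<^sup>2 * (\<Sum>i. (d i)\<^sup>2)"
        using sum_r2 sum_rd sum_d2
        by (simp add: suminf_add[symmetric] suminf_mult summable_add summable_mult)
      finally have 1: "(\<Sum>i. (integral\<^sup>L M (f i))\<^sup>2) = \<dots>" .
      \<comment> \<open>Replacing the negated integral under \<open>\<theta>\<close> by its positive
        part \<open>q\<close> gives only an upper bound, and an upper bound on \<open>J M\<close> is
        what minimality calls for.\<close>
      have "- integral\<^sup>L M c \<le> q + t * e"
      proof -
        have "(1 - t) * - integral\<^sup>L \<theta> c \<le> (1 - t) * q"
          using t by (intro mult_left_mono) (auto simp: q_def)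
        then show ?thesis by (simp add: M_int[OF c] e_def algebra_simps)
      qed
      then have "(max 0 (- integral\<^sup>L M c))\<^sup>2 \<le> (q + t * e)\<^sup>2"
      proof (cases "integral\<^sup>L M c \<ge> 0")
        case False
        then show ?thesis using \<open>- integral\<^sup>L M c \<le> q + t * e\<close> by (intro power_mono) auto
      qed simp
      also have "\<dots> = q\<^sup>2 + 2 * t * (q * e) + t\<^sup>2 * e\<^sup>2" by (simp add: power2_eq_square algebra_simps)
      finally have "J M \<le> J \<theta> + t * (2 * A + t * C)"
        unfolding J_def[of M] 1 J_eq A_def C_def by (simp add: power2_eq_square algebra_simps)
      then have "0 \<le> t * (2 * A + t * C)" using J_min[OF M] by linarith
      then show ?thesis using t by (simp add: zero_le_mult_iff)
    qed
    \<comment> \<open>Let \<open>t\<close> tend to 0 from the right; expanding \<open>A\<close> then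
      turns its sign into the claim, since \<open>J \<theta>\<close> is the sum of the squares of
      all \<open>r i\<close> and of \<open>q\<close>.\<close>
    have "0 \<le> 2 * A"
    proof (rule tendsto_lowerbound)
      show "((\<lambda>t. 2 * A + t * C) \<longlongrightarrow> 2 * A) (at_right 0)"
        by (rule tendsto_eq_rhs[where x="2 * A + 0 * C"]) (intro tendsto_intros, simp)
      show "\<forall>\<^sub>F t in at_right 0. 0 \<le> 2 * A + t * C"
        using eventually_at_right_less[of 0] eventually_at_right[of 0 1]
        by (auto simp: eventually_at_right_field intro!: exI[of _ 1] quad)
    qed auto
    moreover have "A = (\<Sum>i. r i * f i z) - (\<Sum>i. (r i)\<^sup>2) + q * (- c z - q)"
      unfolding A_def rd_eq e_def using sum_rf sum_r2 by (simp add: suminf_diff)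
    moreover have "(\<Sum>i. - r i * f i z) = - (\<Sum>i. r i * f i z)"
      using suminf_minus[OF sum_rf] by simp
    ultimately show ?thesis by (simp add: J_eq power2_eq_square algebra_simps)
  qed
  show ?thesis
  \<comment> \<open>With zero defect \<open>\<theta>\<close> solves the moment problem. Otherwise
    the multipliers are \<open>- r i\<close> and \<open>q\<close>, and the gap is
    \<open>J \<theta>\<close> itself.\<close>
  proof (cases "J \<theta> = 0")
    case True
    moreover have "0 \<le> (\<Sum>i. (r i)\<^sup>2)" using sum_r2 by (intro suminf_nonneg) auto
    ultimately have "(\<Sum>i. (r i)\<^sup>2) = 0" "q\<^sup>2 = 0" unfolding J_eq by (auto simp: add_nonneg_eq_0_iff)
    then have "\<forall>i. r i = 0" "0 \<le> integral\<^sup>L \<theta> c"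
      using suminf_eq_zero_iff[OF sum_r2] by (auto simp: q_def max_def split: if_splits)
    then show ?thesis using \<theta> by (auto simp: r_def)
  next
    case False
    then have "0 < J \<theta>" using J_nonneg[OF \<theta>] by simp
    then show ?thesis
      using key r_le1 by (intro disjI2 exI[of _ "\<lambda>i. - r i"] exI[of _ q] exI[of _ "J \<theta>"]) (auto simp: q_def)
  qed
qed

section \<open>Duality\<close>

lemma borel_prob_on_set_integrable_continuous:
  fixes f :: "'a::euclidean_space \<Rightarrow> real"
  assumes K: "compact K" and M: "borel_prob_on K M" and f: "continuous_on K f"
  shows "set_integrable M K f"
proof -
  note M = borel_prob_onD[OF M]
  interpret prob_space M by (rule M)
  have "bounded (f ` K)"
    using K f by (intro compact_imp_bounded compact_continuous_image)
  then obtain B where B: "\<And>z. z \<in> K \<Longrightarrow> norm (f z) \<le> B" by (auto simp: bounded_iff)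
  show ?thesis
    unfolding set_integrable_def
  proof (rule integrable_const_bound[where B="\<bar>B\<bar>"])
    show "AE z in M. norm (indicator K z *\<^sub>R f z) \<le> \<bar>B\<bar>"
    proof (rule AE_I2)
      show "norm (indicator K z *\<^sub>R f z) \<le> \<bar>B\<bar>" for z
        using B[of z] by (cases "z \<in> K") auto
    qed
    show "(\<lambda>z. indicator K z *\<^sub>R f z) \<in> borel_measurable M"
      unfolding measurable_cong_sets[OF M(2) refl]
      by (rule borel_measurable_continuous_on_indicator[OF M(5) f])
  qed
qed

lemma borel_prob_on_set_integral:
  fixes f :: "'a::euclidean_space \<Rightarrow> real"
  assumes M: "borel_prob_on K M" and f: "f \<in> borel_measurable borel"
  shows "(LINT z:K|M. f z) = integral\<^sup>L M f"
proof -
  note M = borel_prob_onD[OF M]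
  have [measurable]: "f \<in> borel_measurable M" "K \<in> sets M"
    using f M by (simp_all add: measurable_cong_sets[OF M(2) refl])
  show ?thesis
    unfolding set_lebesgue_integral_def
    by (rule integral_cong_AE) (use M(6) in \<open>auto elim!: eventually_mono\<close>)
qed

text \<open>The geometric bound gives uniform convergence, hence continuity, and permits termwise
  integration. This turns a bounded sequence of multipliers into one continuous dual function of
  mean zero.\<close>

lemma borel_prob_on_weighted_series:
  fixes P :: "nat \<Rightarrow> 'a::euclidean_space \<Rightarrow> real"
  assumes K: "compact K" and M: "borel_prob_on K M"
    and P: "\<And>j. continuous_on UNIV (P j)" and P_le: "\<And>j z. \<bar>P j z\<bar> \<le> (1 / 2) ^ j"
    and \<rho>: "\<And>j. \<bar>\<rho> j\<bar> \<le> 1" and P_int: "\<And>j. integral\<^sup>L M (P j) = 0"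
  shows "\<And>z. summable (\<lambda>j. \<rho> j * P j z)"
    and "continuous_on UNIV (\<lambda>z. \<Sum>j. \<rho> j * P j z)"
    and "(\<integral>z. (\<Sum>j. \<rho> j * P j z) \<partial>M) = 0"
proof -
  have geo: "summable (\<lambda>j. (1 / 2) ^ j :: real)" by (rule summable_geometric) auto
  have le: "norm (\<rho> j * P j z) \<le> (1 / 2) ^ j" for j z
  proof -
    have "\<bar>\<rho> j\<bar> * \<bar>P j z\<bar> \<le> 1 * (1 / 2) ^ j" by (intro mult_mono \<rho> P_le) auto
    then show ?thesis by (simp add: abs_mult)
  qed
  show "summable (\<lambda>j. \<rho> j * P j z)" for z
    by (rule summable_comparison_test'[OF geo le])
  have cont: "continuous_on UNIV (\<lambda>z. \<rho> j * P j z)" for j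
    by (intro continuous_intros P)
  have "uniform_limit UNIV (\<lambda>n z. \<Sum>j<n. \<rho> j * P j z) (\<lambda>z. \<Sum>j. \<rho> j * P j z) sequentially"
    by (rule Weierstrass_m_test[OF le geo])
  then show "continuous_on UNIV (\<lambda>z. \<Sum>j. \<rho> j * P j z)"
    by (rule uniform_limit_theorem[rotated])
       (auto intro!: always_eventually allI continuous_on_sum cont simp del: eventually_sequentially)
  interpret prob_space M by (rule borel_prob_onD[OF M])
  have int: "integrable M (\<lambda>z. \<rho> j * P j z)" for j
    by (rule borel_prob_on_integrable_continuous[OF K M cont])
  have int_le: "(\<integral>z. norm (\<rho> j * P j z) \<partial>M) \<le> (1 / 2) ^ j" for j
  proof -
    have "(\<integral>z. norm (\<rho> j * P j z) \<partial>M) \<le> (\<integral>z. (1 / 2) ^ j \<partial>M)"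
      by (intro integral_mono integrable_norm int le) auto
    then show ?thesis by (simp add: prob_space)
  qed
  have "(\<integral>z. (\<Sum>j. \<rho> j * P j z) \<partial>M) = (\<Sum>j. \<integral>z. \<rho> j * P j z \<partial>M)"
  proof (rule integral_suminf[OF int])
    show "AE z in M. summable (\<lambda>j. norm (\<rho> j * P j z))"
      by (intro AE_I2 summable_comparison_test'[OF geo]) (use le in auto)
    show "summable (\<lambda>j. \<integral>z. norm (\<rho> j * P j z) \<partial>M)"
      by (rule summable_comparison_test'[OF geo]) (use int_le in \<open>simp add: abs_of_nonneg integral_nonneg\<close>)
  qed
  then show "(\<integral>z. (\<Sum>j. \<rho> j * P j z) \<partial>M) = 0" by (simp add: P_int)
qed

section \<open>Projections, marginals and the product coupling\<close>

lemma continuous_on_projections: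
  "continuous_on UNIV (\<lambda>(x, y, u). (x, y))" "continuous_on UNIV (\<lambda>(x, y, u). (x, u))"
  "continuous_on UNIV (\<lambda>(x, y, u). inner u y)"
  by (auto simp: case_prod_unfold intro!: continuous_intros)

lemma borel_prob_on_marg1_pair_measure:
  fixes \<nu> :: "('a::euclidean_space \<times> 'b::euclidean_space) measure" and \<mu> :: "'b measure"
  assumes K: "compact K1" "compact K2" "compact K3"
    and \<nu>: "borel_prob_on (K1 \<times> K2) \<nu>" and \<mu>: "borel_prob_on K3 \<mu>"
  shows "borel_prob_on (K1 \<times> K3) (marg1 \<nu> \<Otimes>\<^sub>M \<mu>)"
proof -
  note \<nu> = borel_prob_onD[OF \<nu>] and \<mu> = borel_prob_onD[OF \<mu>]
  note [measurable_cong] = \<nu>(2) \<mu>(2)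
  interpret \<nu>: prob_space \<nu> by (rule \<nu>)
  interpret \<mu>: prob_space \<mu> by (rule \<mu>)
  have fst: "fst \<in> borel_measurable \<nu>"
    unfolding measurable_cong_sets[OF \<nu>(2) refl]
    by (intro borel_measurable_continuous_onI continuous_intros)
  interpret m: prob_space "marg1 \<nu>"
    unfolding marg1_def by (rule \<nu>.prob_space_distr[OF fst])
  interpret P: pair_prob_space "marg1 \<nu>" \<mu> ..
  have K1: "K1 \<in> sets borel" using K by (simp add: borel_compact)
  have "AE x in marg1 \<nu>. x \<in> K1"
    unfolding marg1_def using \<nu>(6) K1
    by (subst AE_distr_iff[OF fst]) (auto elim!: eventually_mono)
  then have "emeasure (marg1 \<nu>) K1 = 1"
    using K1 m.AE_in_set_eq_1[of K1] unfolding m.emeasure_eq_measure by (simp add: marg1_def)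
  then have "emeasure (marg1 \<nu> \<Otimes>\<^sub>M \<mu>) (K1 \<times> K3) = 1"
    using K1 \<mu> by (subst \<mu>.emeasure_pair_measure_Times) (auto simp: marg1_def)
  moreover have "sets (marg1 \<nu> \<Otimes>\<^sub>M \<mu>) = sets borel"
    unfolding borel_prod[symmetric] by (intro sets_pair_measure_cong) (auto simp: marg1_def \<mu>)
  ultimately show ?thesis
    using P.prob_space_axioms by (simp add: borel_prob_on_def)
qed

text \<open>Drawing \<open>u\<close> independently of the pair \<open>(x, y)\<close> gives the right
  marginals. This coupling bounds the dual values from below and rules out a vanishing cost
  multiplier.\<close>

lemma product_coupling_in_I_set:
  fixes \<nu> :: "('a::euclidean_space \<times> 'b::euclidean_space) measure" and \<mu> :: "'b measure"
  assumes K: "compact K1" "compact K2" "compact K3"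
    and \<nu>: "borel_prob_on (K1 \<times> K2) \<nu>" and \<mu>: "borel_prob_on K3 \<mu>"
  shows "distr (\<nu> \<Otimes>\<^sub>M \<mu>) borel (\<lambda>((x, y), u). (x, y, u)) \<in> I_set K1 K2 K3 \<mu> \<nu>"
proof -
  note \<nu> = borel_prob_onD[OF \<nu>] and \<mu> = borel_prob_onD[OF \<mu>]
  note [measurable_cong] = \<nu>(2) \<mu>(2)
  interpret \<nu>: prob_space \<nu> by (rule \<nu>)
  interpret \<mu>: prob_space \<mu> by (rule \<mu>)
  interpret P: pair_prob_space \<nu> \<mu> ..
  have sets_P: "sets (\<nu> \<Otimes>\<^sub>M \<mu>) = sets borel"
    using sets_pair_measure_cong[OF \<nu>(2) \<mu>(2)] unfolding borel_prod .
  have h: "(\<lambda>((x, y), u). (x, y, u)) \<in> borel_measurable (\<nu> \<Otimes>\<^sub>M \<mu>)"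
    unfolding measurable_cong_sets[OF sets_P refl]
    by (rule borel_measurable_continuous_onI) (auto simp: case_prod_unfold intro!: continuous_intros)
  have fst: "fst \<in> borel_measurable \<nu>"
    unfolding measurable_cong_sets[OF \<nu>(2) refl]
    by (intro borel_measurable_continuous_onI continuous_intros)
  let ?\<theta> = "distr (\<nu> \<Otimes>\<^sub>M \<mu>) borel (\<lambda>((x, y), u). (x, y, u))"
  have "borel_prob_on (K1 \<times> K2 \<times> K3) ?\<theta>"
    unfolding borel_prob_on_def
  proof (intro conjI)
    show "prob_space ?\<theta>" by (rule P.prob_space_distr[OF h])
    have "emeasure ?\<theta> (K1 \<times> K2 \<times> K3) =
        emeasure (\<nu> \<Otimes>\<^sub>M \<mu>) ((\<lambda>((x, y), u). (x, y, u)) -` (K1 \<times> K2 \<times> K3) \<inter> space (\<nu> \<Otimes>\<^sub>M \<mu>))"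
      using K by (intro emeasure_distr[OF h] borel_compact compact_Times)
    also have "(\<lambda>((x, y), u). (x, y, u)) -` (K1 \<times> K2 \<times> K3) \<inter> space (\<nu> \<Otimes>\<^sub>M \<mu>) = (K1 \<times> K2) \<times> K3"
      by (auto simp: space_pair_measure \<nu> \<mu>)
    also have "emeasure (\<nu> \<Otimes>\<^sub>M \<mu>) ((K1 \<times> K2) \<times> K3) = 1"
      using \<nu> \<mu> by (subst \<mu>.emeasure_pair_measure_Times) auto
    finally show "emeasure ?\<theta> (K1 \<times> K2 \<times> K3) = 1" .
  qed simp
  moreover have "distr ?\<theta> borel (\<lambda>(x, y, u). (x, y)) = \<nu>"
  proof -
    have "distr ?\<theta> borel (\<lambda>(x, y, u). (x, y)) = distr (\<nu> \<Otimes>\<^sub>M \<mu>) borel fst"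
      by (subst distr_distr[OF borel_measurable_continuous_onI[OF continuous_on_projections(1)] h])
         (auto simp: comp_def case_prod_unfold intro!: distr_cong)
    also have "\<dots> = distr (\<nu> \<Otimes>\<^sub>M \<mu>) \<nu> fst" by (rule distr_cong) (auto simp: \<nu>)
    also have "\<dots> = \<nu>" by (rule \<mu>.distr_pair_fst)
    finally show ?thesis .
  qed
  moreover have "distr ?\<theta> borel (\<lambda>(x, y, u). (x, u)) = marg1 \<nu> \<Otimes>\<^sub>M \<mu>"
  proof -
    \<comment> \<open>Writing \<open>\<mu>\<close> as its own image under the identity lets the
      second marginal be computed as the image of a product under a product map.\<close>
    have id: "distr \<mu> borel (\<lambda>u. u) = \<mu>" by (rule distr_id2) (simp add: \<mu>)
    have "distr ?\<theta> borel (\<lambda>(x, y, u). (x, u)) = distr (\<nu> \<Otimes>\<^sub>M \<mu>) (borel \<Otimes>\<^sub>M borel) (\<lambda>(z, u). (fst z, u))"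
      unfolding borel_prod
      by (subst distr_distr[OF borel_measurable_continuous_onI[OF continuous_on_projections(2)] h])
         (auto simp: comp_def case_prod_unfold intro!: distr_cong)
    also have "\<dots> = distr \<nu> borel fst \<Otimes>\<^sub>M distr \<mu> borel (\<lambda>u. u)"
      by (rule pair_measure_distr[symmetric, OF fst])
         (auto simp: id measurable_cong_sets[OF \<mu>(2) refl] intro: \<mu>.sigma_finite_measure_axioms)
    finally show ?thesis by (simp add: id marg1_def)
  qed
  ultimately show ?thesis by (simp add: I_set_def)
qed

lemma primal_obj_le_dual_obj:
  fixes K1 :: "'a::euclidean_space set" and K2 K3 :: "'b::euclidean_space set"
  assumes K: "compact K1" "compact K2" "compact K3"
    and \<theta>: "\<theta> \<in> I_set K1 K2 K3 \<mu> \<nu>"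
    and \<psi>: "set_integrable \<nu> (K1 \<times> K2) \<psi>"
    and \<phi>: "set_integrable (marg1 \<nu> \<Otimes>\<^sub>M \<mu>) (K1 \<times> K3) \<phi>"
    and feas: "dual_feasible K1 K2 K3 \<psi> \<phi>"
  shows "primal_obj \<theta> \<le> dual_obj K1 K2 K3 \<mu> \<nu> \<psi> \<phi>"
proof -
  have bp: "borel_prob_on (K1 \<times> K2 \<times> K3) \<theta>"
    and d1: "distr \<theta> borel (\<lambda>(x, y, u). (x, y)) = \<nu>"
    and d2: "distr \<theta> borel (\<lambda>(x, y, u). (x, u)) = marg1 \<nu> \<Otimes>\<^sub>M \<mu>"
    using \<theta> by (auto simp: I_set_def)
  note \<theta>D = borel_prob_onD[OF bp]
  have cK: "compact (K1 \<times> K2 \<times> K3)" using K by (intro compact_Times)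
  have m1: "(\<lambda>(x, y, u). (x, y)) \<in> borel_measurable \<theta>"
    and m2: "(\<lambda>(x, y, u). (x, u)) \<in> borel_measurable \<theta>"
    unfolding measurable_cong_sets[OF \<theta>D(2) refl]
    by (rule borel_measurable_continuous_onI[OF continuous_on_projections(1)],
        rule borel_measurable_continuous_onI[OF continuous_on_projections(2)])
  \<comment> \<open>Set integrability controls the functions only on the compact sets. Their
    extensions by zero are Borel on the whole space, so the change of variables along the
    projections applies.\<close>
  define \<Psi> where "\<Psi> z = indicator (K1 \<times> K2) z *\<^sub>R \<psi> z" for z
  define \<Phi> where "\<Phi> z = indicator (K1 \<times> K3) z *\<^sub>R \<phi> z" for z
  have \<Psi>: "integrable (distr \<theta> borel (\<lambda>(x, y, u). (x, y))) \<Psi>"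
    and \<Phi>: "integrable (distr \<theta> borel (\<lambda>(x, y, u). (x, u))) \<Phi>"
    using \<psi> \<phi> unfolding d1 d2 set_integrable_def \<Psi>_def \<Phi>_def by auto
  have \<Psi>m: "\<Psi> \<in> borel_measurable borel" and \<Phi>m: "\<Phi> \<in> borel_measurable borel"
    using borel_measurable_integrable[OF \<Psi>] borel_measurable_integrable[OF \<Phi>] by simp_all
  have i1: "integrable \<theta> (\<lambda>w. \<Psi> ((\<lambda>(x, y, u). (x, y)) w))"
    using \<Psi> integrable_distr_eq[OF m1 \<Psi>m] by blast
  have i2: "integrable \<theta> (\<lambda>w. \<Phi> ((\<lambda>(x, y, u). (x, u)) w))"
    using \<Phi> integrable_distr_eq[OF m2 \<Phi>m] by blast
  have "primal_obj \<theta> \<le> (\<integral>w. \<Psi> ((\<lambda>(x, y, u). (x, y)) w) + \<Phi> ((\<lambda>(x, y, u). (x, u)) w) \<partial>\<theta>)"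
    unfolding primal_obj_def
  proof (rule integral_mono_AE)
    show "integrable \<theta> (\<lambda>(x, y, u). inner u y)"
      by (rule borel_prob_on_integrable_continuous[OF cK bp continuous_on_projections(3)])
    show "AE w in \<theta>. (case w of (x, y, u) \<Rightarrow> inner u y) \<le> \<Psi> ((\<lambda>(x, y, u). (x, y)) w) + \<Phi> ((\<lambda>(x, y, u). (x, u)) w)"
      using \<theta>D(6) feas
      by (auto elim!: eventually_mono simp: \<Psi>_def \<Phi>_def dual_feasible_def)
  qed (intro Bochner_Integration.integrable_add i1 i2)
  also have "\<dots> = (\<integral>w. \<Psi> ((\<lambda>(x, y, u). (x, y)) w) \<partial>\<theta>) + (\<integral>w. \<Phi> ((\<lambda>(x, y, u). (x, u)) w) \<partial>\<theta>)"
    by (rule Bochner_Integration.integral_add[OF i1 i2])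
  also have "\<dots> = dual_obj K1 K2 K3 \<mu> \<nu> \<psi> \<phi>"
    unfolding dual_obj_def set_lebesgue_integral_def \<Psi>_def[symmetric] \<Phi>_def[symmetric]
    unfolding integral_distr[OF m1 \<Psi>m, symmetric] integral_distr[OF m2 \<Phi>m, symmetric] d1 d2 ..
  finally show ?thesis .
qed

text \<open>The moment alternative is applied to the marginal equations and the inequality for the
  cost minus \<open>V\<close>. Its second branch would produce a continuous feasible pair of value
  below the lower bound \<open>V\<close>.\<close>

lemma primal_attains_dual_values_C:
  fixes K1 :: "'a::euclidean_space set" and K2 K3 :: "'b::euclidean_space set"
    and \<nu> :: "('a \<times> 'b) measure" and \<mu> :: "'b measure"
  assumes K: "compact K1" "compact K2" "compact K3"
    and \<nu>: "borel_prob_on (K1 \<times> K2) \<nu>" and \<mu>: "borel_prob_on K3 \<mu>"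
    and V: "\<And>v. v \<in> dual_values_C K1 K2 K3 \<mu> \<nu> \<Longrightarrow> V \<le> v"
  shows "\<exists>\<theta>\<in>I_set K1 K2 K3 \<mu> \<nu>. V \<le> primal_obj \<theta>"
proof -
  define KK where "KK = K1 \<times> K2 \<times> K3"
  define \<pi>1 where "\<pi>1 = (\<lambda>(x :: 'a, y :: 'b, u :: 'b). (x, y))"
  define \<pi>2 where "\<pi>2 = (\<lambda>(x :: 'a, y :: 'b, u :: 'b). (x, u))"
  define c where "c = (\<lambda>(x :: 'a, y :: 'b, u :: 'b). inner u y)"
  define M2 where "M2 = marg1 \<nu> \<Otimes>\<^sub>M \<mu>"
  have cK: "compact KK" "compact (K1 \<times> K2)" "compact (K1 \<times> K3)"
    unfolding KK_def using K by (auto intro!: compact_Times)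
  have \<pi>1: "continuous_on UNIV \<pi>1" and \<pi>2: "continuous_on UNIV \<pi>2" and c: "continuous_on UNIV c"
    unfolding \<pi>1_def \<pi>2_def c_def by (fact continuous_on_projections)+
  have M2: "borel_prob_on (K1 \<times> K3) M2"
    unfolding M2_def by (rule borel_prob_on_marg1_pair_measure[OF K \<nu> \<mu>])
  note \<nu>D = borel_prob_onD[OF \<nu>] and M2D = borel_prob_onD[OF M2]
  obtain \<theta>0 where "\<theta>0 \<in> I_set K1 K2 K3 \<mu> \<nu>" using product_coupling_in_I_set[OF K \<nu> \<mu>] by blast
  then have \<theta>0: "borel_prob_on KK \<theta>0" "distr \<theta>0 borel \<pi>1 = \<nu>" "distr \<theta>0 borel \<pi>2 = M2"
    by (auto simp: I_set_def KK_def \<pi>1_def \<pi>2_def M2_def)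
  have int1: "(\<integral>w. g (\<pi>1 w) \<partial>\<theta>) = integral\<^sup>L (distr \<theta> borel \<pi>1) g"
    and int2: "(\<integral>w. g (\<pi>2 w) \<partial>\<theta>) = integral\<^sup>L (distr \<theta> borel \<pi>2) g"
    if "borel_prob_on KK \<theta>" "continuous_on UNIV g" for \<theta> and g :: "'a \<times> 'b \<Rightarrow> real"
    using borel_prob_onD[OF that(1)]
    by (auto simp: integral_distr borel_measurable_continuous_onI[OF that(2)]
          measurable_cong_sets[OF borel_prob_onD(2)[OF that(1)] refl]
          borel_measurable_continuous_onI[OF \<pi>1] borel_measurable_continuous_onI[OF \<pi>2])
  obtain p :: "nat \<Rightarrow> 'a \<times> 'b \<Rightarrow> real"
    where p: "\<And>i. continuous_on UNIV (p i)" and p0: "\<And>i z. 0 \<le> p i z" and p1: "\<And>i z. p i z \<le> 1"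
      and p_det: "measure_determining p"
    by (rule countable_measure_determining_family) (rule that)
  \<comment> \<open>Even indices test the first marginal, odd ones the second. Subtracting the
    prescribed mean makes each marginal condition a vanishing moment, and the weights supply the
    required geometric bound.\<close>
  define P where "P j z = (if even j then (1 / 2) ^ j * (p (j div 2) z - integral\<^sup>L \<nu> (p (j div 2))) else 0)" for j z
  define Q where "Q j z = (if odd j then (1 / 2) ^ j * (p (j div 2) z - integral\<^sup>L M2 (p (j div 2))) else 0)" for j z
  have P_cont: "continuous_on UNIV (P j)" and Q_cont: "continuous_on UNIV (Q j)" for j
    unfolding P_def Q_def by (cases "even j"; auto intro!: continuous_intros p)+
  have p_int: "0 \<le> integral\<^sup>L M (p i)" "integral\<^sup>L M (p i) \<le> 1"
    if "borel_prob_on L M" "compact L" for L M i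
    using borel_prob_on_integral_abs_le[OF that(2,1) p[of i], of 1] p0 p1
    by (auto simp: abs_le_iff integral_nonneg intro: order_trans[of _ 0])
  have diff_le: "\<bar>p i z - integral\<^sup>L M (p i)\<bar> \<le> 1" if "borel_prob_on L M" "compact L" for L M i z
    using p_int[OF that, of i] p0[of i z] p1[of i z] by auto
  have P_le: "\<bar>P j z\<bar> \<le> (1 / 2) ^ j" and Q_le: "\<bar>Q j z\<bar> \<le> (1 / 2) ^ j" for j z
    using diff_le[OF \<nu> cK(2), of "j div 2" z] diff_le[OF M2 cK(3), of "j div 2" z]
    by (auto simp: P_def Q_def abs_mult intro!: mult_left_le)
  have center: "(\<integral>z. p i z - integral\<^sup>L M (p i) \<partial>M) = 0"
    if "borel_prob_on L M" "compact L" for L M i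
  proof -
    interpret prob_space M by (rule borel_prob_onD[OF that(1)])
    show ?thesis
      using borel_prob_on_integrable_continuous[OF that(2,1) p[of i]] by (simp add: prob_space)
  qed
  have P_int: "integral\<^sup>L \<nu> (P j) = 0" and Q_int: "integral\<^sup>L M2 (Q j) = 0" for j
    unfolding P_def Q_def 
    by (cases "even j"; simp add: center[OF \<nu> cK(2)] center[OF M2 cK(3)])+
  define f where "f j w = P j (\<pi>1 w) + Q j (\<pi>2 w)" for j w
  have f_cont: "continuous_on UNIV (f j)" for j
    unfolding f_def
    by (intro continuous_intros continuous_on_compose2[OF P_cont \<pi>1] continuous_on_compose2[OF Q_cont \<pi>2]) auto
  have f_le: "\<bar>f j w\<bar> \<le> (1 / 2) ^ j" for j w
    using P_le[of j "\<pi>1 w"] Q_le[of j "\<pi>2 w"] by (cases "even j") (auto simp: f_def P_def Q_def)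
  have c': "continuous_on UNIV (\<lambda>w. c w - V)" by (intro continuous_intros c)
  have c'_int: "(\<integral>w. c w - V \<partial>\<theta>) = integral\<^sup>L \<theta> c - V" if "borel_prob_on KK \<theta>" for \<theta>
    using borel_prob_on_integrable_continuous[OF cK(1) that c]
      prob_space.prob_space[OF borel_prob_onD(1)[OF that]] borel_prob_onD(1)[OF that]
    by (subst Bochner_Integration.integral_diff)
       (auto intro: prob_space.finite_measure finite_measure.integrable_const)
  from moment_alternative[OF cK(1) \<theta>0(1) f_cont f_le c'] show ?thesis
  proof (elim disjE exE conjE)
    fix \<theta> assume \<theta>: "borel_prob_on KK \<theta>" and zero: "\<forall>i. integral\<^sup>L \<theta> (f i) = 0"
      and ge: "0 \<le> (\<integral>w. c w - V \<partial>\<theta>)"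
    note \<theta>D = borel_prob_onD[OF \<theta>]
    interpret \<theta>: prob_space \<theta> by (rule \<theta>D)
    have m: "\<pi>1 \<in> borel_measurable \<theta>" "\<pi>2 \<in> borel_measurable \<theta>"
      unfolding measurable_cong_sets[OF \<theta>D(2) refl]
      by (rule borel_measurable_continuous_onI[OF \<pi>1], rule borel_measurable_continuous_onI[OF \<pi>2])
    have cont12: "continuous_on UNIV (\<lambda>w. p i (\<pi>1 w))" "continuous_on UNIV (\<lambda>w. p i (\<pi>2 w))" for i
      using continuous_on_compose2[OF p \<pi>1] continuous_on_compose2[OF p \<pi>2] by auto
    have ints: "integrable \<theta> (\<lambda>w. p i (\<pi>1 w))" "integrable \<theta> (\<lambda>w. p i (\<pi>2 w))" for i
      using borel_prob_on_integrable_continuous[OF cK(1) \<theta> cont12(1)]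
        borel_prob_on_integrable_continuous[OF cK(1) \<theta> cont12(2)] by auto
    have "distr \<theta> borel \<pi>1 = \<nu>"
    proof (rule measure_determiningD[OF p_det])
      show "prob_space (distr \<theta> borel \<pi>1)" by (rule \<theta>.prob_space_distr[OF m(1)])
      fix i
      have "0 = (\<integral>w. (1 / 2) ^ (2 * i) * (p i (\<pi>1 w) - integral\<^sup>L \<nu> (p i)) \<partial>\<theta>)"
        using zero[rule_format, of "2 * i"] unfolding f_def P_def Q_def by simp
      also have "\<dots> = (1 / 2) ^ (2 * i) * ((\<integral>w. p i (\<pi>1 w) \<partial>\<theta>) - integral\<^sup>L \<nu> (p i))"
        using ints(1)[of i] by (simp add: \<theta>.prob_space)
      finally show "integral\<^sup>L (distr \<theta> borel \<pi>1) (p i) = integral\<^sup>L \<nu> (p i)"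
        using int1[OF \<theta> p[of i]] by simp
    qed (use \<nu>D in auto)
    moreover have "distr \<theta> borel \<pi>2 = M2"
    proof (rule measure_determiningD[OF p_det])
      show "prob_space (distr \<theta> borel \<pi>2)" by (rule \<theta>.prob_space_distr[OF m(2)])
      fix i
      have "0 = (\<integral>w. (1 / 2) ^ (2 * i + 1) * (p i (\<pi>2 w) - integral\<^sup>L M2 (p i)) \<partial>\<theta>)"
        using zero[rule_format, of "2 * i + 1"] unfolding f_def P_def Q_def by simp
      also have "\<dots> = (1 / 2) ^ (2 * i + 1) * ((\<integral>w. p i (\<pi>2 w) \<partial>\<theta>) - integral\<^sup>L M2 (p i))"
        using ints(2)[of i] by (simp add: \<theta>.prob_space)
      finally show "integral\<^sup>L (distr \<theta> borel \<pi>2) (p i) = integral\<^sup>L M2 (p i)"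
        using int2[OF \<theta> p[of i]] by simp
    qed (use M2D in auto)
    ultimately have "\<theta> \<in> I_set K1 K2 K3 \<mu> \<nu>"
      using \<theta> by (simp add: I_set_def KK_def \<pi>1_def \<pi>2_def M2_def)
    moreover have "V \<le> primal_obj \<theta>"
      using ge c'_int[OF \<theta>] by (simp add: primal_obj_def c_def)
    ultimately show ?thesis by blast
  next
    fix \<rho> \<kappa> \<eta> assume \<rho>: "\<forall>i. \<bar>\<rho> i\<bar> \<le> 1" and "0 \<le> \<kappa>" "0 < \<eta>"
      and sep: "\<forall>w\<in>KK. (\<Sum>i. \<rho> i * f i w) + \<kappa> * (c w - V) \<le> - \<eta>"
    define \<Psi> where "\<Psi> z = (\<Sum>j. \<rho> j * P j z)" for z
    define \<Phi> where "\<Phi> z = (\<Sum>j. \<rho> j * Q j z)" for z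
    note SP = borel_prob_on_weighted_series[where \<rho>=\<rho>, OF cK(2) \<nu> P_cont P_le \<rho>[rule_format] P_int, folded \<Psi>_def]
    note SQ = borel_prob_on_weighted_series[where \<rho>=\<rho>, OF cK(3) M2 Q_cont Q_le \<rho>[rule_format] Q_int, folded \<Phi>_def]
    \<comment> \<open>The separating series splits into a function of \<open>(x, y)\<close> and a
      function of \<open>(x, u)\<close>, which is the shape of a dual pair.\<close>
    have "(\<Sum>i. \<rho> i * f i w) = \<Psi> (\<pi>1 w) + \<Phi> (\<pi>2 w)" for w
      unfolding \<Psi>_def \<Phi>_def suminf_add[OF SP(1) SQ(1)] f_def by (simp add: algebra_simps)
    then have sep': "\<Psi> (\<pi>1 w) + \<Phi> (\<pi>2 w) + \<kappa> * (c w - V) \<le> - \<eta>" if "w \<in> KK" for w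
      using sep that by simp
    \<comment> \<open>Otherwise integrating the separation against the product coupling gives
      \<open>0 \<le> - \<eta>\<close>, because both series have mean zero under the prescribed
      marginals.\<close>
    have "\<kappa> \<noteq> 0"
    proof
      assume "\<kappa> = 0"
      have cont: "continuous_on UNIV (\<lambda>w. \<Psi> (\<pi>1 w))" "continuous_on UNIV (\<lambda>w. \<Phi> (\<pi>2 w))"
        using continuous_on_compose2[OF SP(2) \<pi>1] continuous_on_compose2[OF SQ(2) \<pi>2] by auto
      note i = borel_prob_on_integrable_continuous[OF cK(1) \<theta>0(1) cont(1)]
        borel_prob_on_integrable_continuous[OF cK(1) \<theta>0(1) cont(2)]
      interpret prob_space \<theta>0 by (rule borel_prob_onD[OF \<theta>0(1)])
      have "(\<integral>w. \<Psi> (\<pi>1 w) + \<Phi> (\<pi>2 w) \<partial>\<theta>0) \<le> (\<integral>w. - \<eta> \<partial>\<theta>0)"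
        using borel_prob_onD(6)[OF \<theta>0(1)] sep' \<open>\<kappa> = 0\<close>
        by (intro integral_mono_AE Bochner_Integration.integrable_add i) (auto elim!: eventually_mono)
      moreover have "(\<integral>w. \<Psi> (\<pi>1 w) + \<Phi> (\<pi>2 w) \<partial>\<theta>0) = 0"
        using int1[OF \<theta>0(1) SP(2)] int2[OF \<theta>0(1) SQ(2)] SP(3) SQ(3) \<theta>0 i by simp
      ultimately show False using \<open>0 < \<eta>\<close> by (simp add: prob_space)
    qed
    with \<open>0 \<le> \<kappa>\<close> have "\<kappa> > 0" by simp
    \<comment> \<open>Solve the separating inequality for the cost. The constants go into
      \<open>\<psi>\<close>, so the pair has value \<open>V - \<eta> / \<kappa>\<close>.\<close>
    define \<psi> where "\<psi> z = V - (\<Psi> z + \<eta>) / \<kappa>" for z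
    define \<phi> where "\<phi> z = - \<Phi> z / \<kappa>" for z
    have cont: "continuous_on UNIV \<psi>" "continuous_on UNIV \<phi>"
      unfolding \<psi>_def \<phi>_def using \<open>\<kappa> \<noteq> 0\<close> by (auto intro!: continuous_intros SP(2) SQ(2))
    have "dual_feasible K1 K2 K3 \<psi> \<phi>"
      unfolding dual_feasible_def
    proof (intro ballI)
      fix x y u assume "x \<in> K1" "y \<in> K2" "u \<in> K3"
      then have "\<Psi> (x, y) + \<Phi> (x, u) + \<kappa> * (inner u y - V) \<le> - \<eta>"
        using sep'[of "(x, y, u)"] by (simp add: KK_def \<pi>1_def \<pi>2_def c_def)
      then have "inner u y - V \<le> - (\<Psi> (x, y) + \<Phi> (x, u) + \<eta>) / \<kappa>"
        unfolding pos_le_divide_eq[OF \<open>\<kappa> > 0\<close>] by (simp add: algebra_simps)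
      then show "inner u y \<le> \<psi> (x, y) + \<phi> (x, u)"
        by (simp add: \<psi>_def \<phi>_def add_divide_distrib diff_divide_distrib)
    qed
    then have "dual_obj K1 K2 K3 \<mu> \<nu> \<psi> \<phi> \<in> dual_values_C K1 K2 K3 \<mu> \<nu>"
      unfolding dual_values_C_def using cont by (auto intro: continuous_on_subset)
    moreover have "dual_obj K1 K2 K3 \<mu> \<nu> \<psi> \<phi> = V - \<eta> / \<kappa>"
    proof -
      interpret \<nu>: prob_space \<nu> by (rule \<nu>D)
      have "integral\<^sup>L \<nu> \<psi> = V - \<eta> / \<kappa>"
        using borel_prob_on_integrable_continuous[OF cK(2) \<nu> SP(2)] SP(3)
        unfolding \<psi>_def by (simp add: \<nu>.prob_space add_divide_distrib)
      moreover have "integral\<^sup>L M2 \<phi> = 0"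
        using SQ(3) unfolding \<phi>_def by simp
      ultimately show ?thesis
        unfolding dual_obj_def M2_def[symmetric]
          borel_prob_on_set_integral[OF \<nu> borel_measurable_continuous_onI[OF cont(1)]]
          borel_prob_on_set_integral[OF M2 borel_measurable_continuous_onI[OF cont(2)]]
        by simp
    qed
    ultimately show ?thesis using V \<open>0 < \<eta>\<close> \<open>\<kappa> > 0\<close> by (fastforce simp: field_simps)
  qed
qed

theorem theoremC1:
  fixes K1 :: "'a::euclidean_space set" and K2 K3 :: "'b::euclidean_space set"
    and \<nu> :: "('a \<times> 'b) measure" and \<mu> :: "'b measure"
  assumes "compact K1" "compact K2" "compact K3"
    and "borel_prob_on (K1 \<times> K2) \<nu>"
    and "(\<integral>x. x \<partial>(marg1 \<nu>)) = 0"
    and "borel_prob_on K3 \<mu>"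
  shows "\<exists>\<theta>\<in>I_set K1 K2 K3 \<mu> \<nu>.
           (\<forall>\<theta>'\<in>I_set K1 K2 K3 \<mu> \<nu>. primal_obj \<theta>' \<le> primal_obj \<theta>) \<and>
           primal_obj \<theta> = Inf (dual_values_C K1 K2 K3 \<mu> \<nu>) \<and>
           primal_obj \<theta> = Inf (dual_values_L1 K1 K2 K3 \<mu> \<nu>)"
proof -
  note K = assms(1-3) and \<nu> = assms(4) and \<mu> = assms(6)
  let ?C = "dual_values_C K1 K2 K3 \<mu> \<nu>" and ?L = "dual_values_L1 K1 K2 K3 \<mu> \<nu>"
  have cK: "compact (K1 \<times> K2)" "compact (K1 \<times> K3)" "compact (K1 \<times> K2 \<times> K3)"
    using K by (auto intro!: compact_Times)
  have sub: "?C \<subseteq> ?L"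
    unfolding dual_values_C_def dual_values_L1_def
    using borel_prob_on_set_integrable_continuous[OF cK(1) \<nu>]
      borel_prob_on_set_integrable_continuous[OF cK(2) borel_prob_on_marg1_pair_measure[OF K \<nu> \<mu>]]
    by blast
  have weak: "primal_obj \<theta> \<le> v" if "\<theta> \<in> I_set K1 K2 K3 \<mu> \<nu>" "v \<in> ?L" for \<theta> v
    using that primal_obj_le_dual_obj[OF K that(1)] unfolding dual_values_L1_def by auto
  have "bounded ((\<lambda>(x, y, u). inner u y) ` (K1 \<times> K2 \<times> K3))"
    by (intro compact_imp_bounded compact_continuous_image cK(3)
          continuous_on_subset[OF continuous_on_projections(3)]) auto
  then obtain B where "\<And>w. w \<in> K1 \<times> K2 \<times> K3 \<Longrightarrow> norm (case w of (x, y, u) \<Rightarrow> inner u y) \<le> B"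
    unfolding bounded_iff by blast
  \<comment> \<open>A constant bound for the cost on the compact product is feasible, so the infima
    are over nonempty sets.\<close>
  then have "dual_feasible K1 K2 K3 (\<lambda>_. B) (\<lambda>_. 0)"
    by (force simp: dual_feasible_def abs_le_iff)
  then have "?C \<noteq> {}"
    unfolding dual_values_C_def by (auto intro: continuous_on_const)
  then have "?L \<noteq> {}" using sub by blast
  obtain \<theta>0 where \<theta>0: "\<theta>0 \<in> I_set K1 K2 K3 \<mu> \<nu>" using product_coupling_in_I_set[OF K \<nu> \<mu>] by blast
  \<comment> \<open>The value of the product coupling is a lower bound, by weak duality.\<close>
  have bdd: "bdd_below ?L" using weak[OF \<theta>0] by (rule bdd_belowI)
  have bddC: "bdd_below ?C" using bdd_below_mono[OF bdd sub] .
  obtain \<theta> where \<theta>: "\<theta> \<in> I_set K1 K2 K3 \<mu> \<nu>" "Inf ?C \<le> primal_obj \<theta>"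
    using primal_attains_dual_values_C[OF K \<nu> \<mu>, of "Inf ?C"] cInf_lower[OF _ bddC] by blast
  have le_L: "primal_obj \<theta>' \<le> Inf ?L" if "\<theta>' \<in> I_set K1 K2 K3 \<mu> \<nu>" for \<theta>'
    using \<open>?L \<noteq> {}\<close> weak[OF that] by (rule cInf_greatest)
  have "Inf ?L \<le> Inf ?C" by (rule cInf_superset_mono[OF \<open>?C \<noteq> {}\<close> bdd sub])
  \<comment> \<open>The chain \<open>primal_obj \<theta> \<le> Inf ?L \<le> Inf ?C \<le> primal_obj
    \<theta>\<close> collapses to equalities, and \<open>le_L\<close> then makes
    \<open>\<theta>\<close> a maximiser.\<close>
  with le_L \<theta> show ?thesis by (intro bexI[OF _ \<theta>(1)]) force
qed

end
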